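(* Let $b\ge 2$ and $s\ge 1$ be integers. Let $\mathcal{P}$ be a digital net over $\mathbb{Z}_b$ in $G^s$, let $\mathcal{P}^{\perp}\subset\mathbb{N}_0^s$ be its dual net, and let $\mathcal{P}^{\mathrm{sym}}$ be the symmetrized point set of $\mathcal{P}$. Let $K:[0,1]^s\times[0,1]^s\to\mathbb{R}$ be a continuous reproducing kernel which satisfies $$\int_{[0,1]^s}\sqrt{K(\boldsymbol{x},\boldsymbol{x})}\,\mathrm{d}\boldsymbol{x}<\infty\quad\text{and}\quad \sum_{\boldsymbol{k},\boldsymbol{l}\in\mathbb{N}_0^s}|\hat{K}(\boldsymbol{k},\boldsymbol{l})|<\infty.$$ Then the squared worst-case error, in the reproducing kernel Hilbert space with kernel $K$, of quasi-Monte Carlo integration over $\pi(\mathcal{P}^{\mathrm{sym}})$ is given by $$e^2(\pi(\mathcal{P}^{\mathrm{sym}}),K)=\sum_{\boldsymbol{k},\boldsymbol{l}\in(\mathcal{P}^{\perp}\cap\mathcal{E}^s)\setminus\{\boldsymbol{0}\}}\hat{K}(\boldsymbol{k},\boldsymbol{l}).$$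
   Context: $\mathbb{N}$ is the set of positive integers, $\mathbb{N}_0=\mathbb{N}\cup\{0\}$, and $\mathbb{Z}_b=\{0,1,\dots,b-1\}$ with arithmetic modulo $b$. Put $G=(\mathbb{Z}_b)^{\mathbb{N}}$, a compact abelian group under componentwise addition $\oplus$ (also used for $G^s$). The projection $\pi:G\to[0,1]$ is $\pi(\zeta_1,\zeta_2,\dots)=\sum_{i\ge1}\zeta_i b^{-i}$, applied componentwise on $G^s$. Walsh functions: each $x\in[0,1)$ has its unique $b$-adic expansion $x=\sum_{i\ge1}\xi_i b^{-i}$ with infinitely many $\xi_i\ne b-1$; for $x=1$ all $\xi_i=b-1$. Let $\omega_b=\exp(2\pi\sqrt{-1}/b)$. For $k=\kappa_0+\kappa_1b+\dots+\kappa_{a-1}b^{a-1}\in\mathbb{N}_0$ with $\kappa_i\in\mathbb{Z}_b$, $\mathrm{wal}_k(x)=\omega_b^{\kappa_0\xi_1+\dots+\kappa_{a-1}\xi_a}$, and $\mathrm{wal}_{\boldsymbol{k}}(\boldsymbol{x})=\prod_{j=1}^s\mathrm{wal}_{k_j}(x_j)$. The Walsh coefficients of $K$ are $\hat K(\boldsymbol{k},\boldsymbol{l})=\int_{[0,1]^{2s}}K(\boldsymbol{x},\boldsymbol{y})\overline{\mathrm{wal}_{\boldsymbol{k}}(\boldsymbol{x})}\mathrm{wal}_{\boldsymbol{l}}(\boldsymbol{y})\,\mathrm{d}\boldsymbol{x}\,\mathrm{d}\boldsymbol{y}$. Digital net in $G^s$: given $m\in\mathbb{N}$ and matrices $C_1,\dots,C_s\in\mathbb{Z}_b^{\mathbb{N}\times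 m}$, for $0\le n<b^m$ with $n=\sum_{i=0}^{m-1}\nu_ib^i$, $\nu_i\in\mathbb{Z}_b$, put $\boldsymbol{z}_n=(z_{n,1},\dots,z_{n,s})\in G^s$ with $z_{n,j}=(\nu_0,\dots,\nu_{m-1})\cdot C_j^{\top}$ (over $\mathbb{Z}_b$). Then $\mathcal{P}=\{\boldsymbol{z}_0,\dots,\boldsymbol{z}_{b^m-1}\}$ is the digital net over $\mathbb{Z}_b$ in $G^s$ with generating matrices $C_1,\dots,C_s$. All point sets are counted with multiplicity. Its dual net is $\mathcal{P}^{\perp}=\{\boldsymbol{k}\in\mathbb{N}_0^s:\vec{k}_1C_1\oplus\dots\oplus\vec{k}_sC_s=(0,\dots,0)\in\mathbb{Z}_b^m\}$, where $\vec{k}_j=(\kappa_{j,0},\kappa_{j,1},\dots)$ is the (finitely supported) row vector of $b$-adic digits of $k_j=\kappa_{j,0}+\kappa_{j,1}b+\cdots$. Symmetrization: for $l\in\mathbb{Z}_b$ let $e_l=(l,l,\dots)\in G$, and for $\boldsymbol{l}\in\mathbb{Z}_b^s$ let $\boldsymbol{e}_{\boldsymbol{l}}=(e_{l_1},\dots,e_{l_s})$. Then $\mathcal{P}^{\mathrm{sym}}=\{\boldsymbol{z}\oplus\boldsymbol{e}_{\boldsymbol{l}}:\boldsymbol{z}\in\mathcal{P},\boldsymbol{l}\in\mathbb{Z}_b^s\}$, counted with multiplicity so that $|\mathcal{P}^{\mathrm{sym}}|=b^s|\mathcal{P}|$. $\mathcal{E}=\{k\in\mathbb{N}_0:\delta(k)\equiv0\pmod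 b\}$, where $\delta(k)=\kappa_0+\kappa_1+\cdots$ is the $b$-adic digit sum of $k=\kappa_0+\kappa_1b+\cdots$. Worst-case error: for a finite point set $P\subset[0,1]^s$ (counted with multiplicity) and the reproducing kernel Hilbert space $\mathcal{H}$ of functions on $[0,1]^s$ with kernel $K$, $e(P,K)=\sup_{f\in\mathcal{H},\|f\|_{\mathcal{H}}\le1}\left|\int_{[0,1]^s}f(\boldsymbol{x})\,\mathrm{d}\boldsymbol{x}-\frac1{|P|}\sum_{\boldsymbol{x}\in P}f(\boldsymbol{x})\right|$ and $e^2(P,K)=(e(P,K))^2$. *)

theory Defs
  imports "HOL-Analysis.Analysis" "HOL-Library.Multiset"
begin

(* All digit sequences are indexed from 0: index i of a sequence stands for the (i+1)-st
   digit after the radix point, and for the (i+1)-st row of a generating matrix. *)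

section \<open>The group and its projection\<close>

(* Elements of G^s are the z :: (nat => nat) ^ 's all of whose digits (z $ j) i are < b. *)

definition add_G :: "nat \<Rightarrow> (nat \<Rightarrow> nat) ^ 's \<Rightarrow> (nat \<Rightarrow> nat) ^ 's \<Rightarrow> (nat \<Rightarrow> nat) ^ 's" where
  "add_G b z w = (\<chi> j. (\<lambda>i. ((z $ j) i + (w $ j) i) mod b))"

definition proj_G :: "nat \<Rightarrow> (nat \<Rightarrow> nat) ^ 's \<Rightarrow> real ^ 's" where
  "proj_G b z = (\<chi> j. \<Sum>i. real ((z $ j) i) / real b ^ Suc i)"

section \<open>Walsh functions and Walsh coefficients\<close>

definition nat_digit :: "nat \<Rightarrow> nat \<Rightarrow> nat \<Rightarrow> nat" where
  "nat_digit b k i = (k div b ^ i) mod b"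

(* The support of the digits; finite for b \<ge> 2. *)
definition digit_supp :: "nat \<Rightarrow> nat \<Rightarrow> nat set" where
  "digit_supp b k = {i. nat_digit b k i \<noteq> 0}"

(* Only meaningful for x in the unit interval. *)
definition real_digits :: "nat \<Rightarrow> real \<Rightarrow> nat \<Rightarrow> nat" where
  "real_digits b x =
     (if x = 1 then (\<lambda>i. b - 1)
      else (THE \<xi>. (\<forall>i. \<xi> i < b) \<and> infinite {i. \<xi> i \<noteq> b - 1} \<and>
                   (\<lambda>i. real (\<xi> i) / real b ^ Suc i) sums x))"

definition omega :: "nat \<Rightarrow> complex" where
  "omega b = exp (2 * of_real pi * \<i> / of_nat b)"

definition wal1 :: "nat \<Rightarrow> nat \<Rightarrow> real \<Rightarrow> complex" where
  "wal1 b k x = omega b ^ (\<Sum>i\<in>digit_supp b k. nat_digit b k i * real_digits b x i)"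

definition wal :: "nat \<Rightarrow> nat ^ 's \<Rightarrow> real ^ 's \<Rightarrow> complex" where
  "wal b k x = (\<Prod>j\<in>UNIV. wal1 b (k $ j) (x $ j))"

abbreviation unit_cube :: "(real ^ 's) set" where
  "unit_cube \<equiv> cbox 0 1"

definition walsh_coeff ::
  "nat \<Rightarrow> (real ^ 's \<Rightarrow> real ^ 's \<Rightarrow> real) \<Rightarrow> nat ^ 's \<Rightarrow> nat ^ 's \<Rightarrow> complex" where
  "walsh_coeff b K k l =
     set_lebesgue_integral lborel (unit_cube \<times> unit_cube)
       (\<lambda>(x, y). of_real (K x y) * cnj (wal b k x) * wal b l y)"

section \<open>Digital nets, dual nets and symmetrization\<close>

(* C j i r is the entry in row i and column r of the j-th matrix; only columns r < m count. *)
definition generating_matrices :: "nat \<Rightarrow> nat \<Rightarrow> ('s \<Rightarrow> nat \<Rightarrow> nat \<Rightarrow> nat) \<Rightarrow> bool" where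
  "generating_matrices b m C \<longleftrightarrow> (\<forall>j i. \<forall>r<m. C j i r < b)"

definition net_point ::
  "nat \<Rightarrow> nat \<Rightarrow> ('s \<Rightarrow> nat \<Rightarrow> nat \<Rightarrow> nat) \<Rightarrow> nat \<Rightarrow> (nat \<Rightarrow> nat) ^ 's" where
  "net_point b m C n = (\<chi> j. (\<lambda>i. (\<Sum>r<m. nat_digit b n r * C j i r) mod b))"

definition digital_net ::
  "nat \<Rightarrow> nat \<Rightarrow> ('s \<Rightarrow> nat \<Rightarrow> nat \<Rightarrow> nat) \<Rightarrow> ((nat \<Rightarrow> nat) ^ 's) multiset" where
  "digital_net b m C = image_mset (net_point b m C) (mset_set {..<b ^ m})"

definition dual_net ::
  "nat \<Rightarrow> nat \<Rightarrow> ('s::finite \<Rightarrow> nat \<Rightarrow> nat \<Rightarrow> nat) \<Rightarrow> (nat ^ 's) set" where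
  "dual_net b m C =
     {k. \<forall>r<m. (\<Sum>j\<in>UNIV. \<Sum>i\<in>digit_supp b (k $ j). nat_digit b (k $ j) i * C j i r) mod b = 0}"

definition const_G :: "nat ^ 's \<Rightarrow> (nat \<Rightarrow> nat) ^ 's" where
  "const_G l = (\<chi> j. (\<lambda>i. l $ j))"

definition symmetrization ::
  "nat \<Rightarrow> ((nat \<Rightarrow> nat) ^ 's) multiset \<Rightarrow> ((nat \<Rightarrow> nat) ^ 's) multiset" where
  "symmetrization b P =
     (\<Sum>z\<in>#P. image_mset (\<lambda>l. add_G b z (const_G l)) (mset_set {l. \<forall>j. l $ j < b}))"

definition digit_sum :: "nat \<Rightarrow> nat \<Rightarrow> nat" where
  "digit_sum b k = (\<Sum>i\<in>digit_supp b k. nat_digit b k i)"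

definition E_set :: "nat \<Rightarrow> nat set" where
  "E_set b = {k. digit_sum b k mod b = 0}"

section \<open>Reproducing kernel Hilbert spaces and the worst-case error\<close>

(* A real Hilbert space H of functions on D with inner product ip and reproducing kernel K.
   A function on D is represented by its extension by 0 to the whole type. Nothing is
   required of K outside D \<times> D or of ip outside H. *)
locale rkhs =
  fixes D :: "'a set"
    and K :: "'a \<Rightarrow> 'a \<Rightarrow> real"
    and H :: "('a \<Rightarrow> real) set"
    and ip :: "('a \<Rightarrow> real) \<Rightarrow> ('a \<Rightarrow> real) \<Rightarrow> real"
  assumes supported: "f \<in> H \<Longrightarrow> x \<notin> D \<Longrightarrow> f x = 0"
    and zero_mem: "(\<lambda>x. 0) \<in> H"
    and add_mem: "f \<in> H \<Longrightarrow> g \<in> H \<Longrightarrow> (\<lambda>x. f x + g x) \<in> H"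
    and scale_mem: "f \<in> H \<Longrightarrow> (\<lambda>x. c * f x) \<in> H"
    and ip_commute: "f \<in> H \<Longrightarrow> g \<in> H \<Longrightarrow> ip f g = ip g f"
    and ip_add: "f \<in> H \<Longrightarrow> g \<in> H \<Longrightarrow> h \<in> H \<Longrightarrow> ip (\<lambda>x. f x + g x) h = ip f h + ip g h"
    and ip_scale: "f \<in> H \<Longrightarrow> g \<in> H \<Longrightarrow> ip (\<lambda>x. c * f x) g = c * ip f g"
    and ip_nonneg: "f \<in> H \<Longrightarrow> ip f f \<ge> 0"
    and ip_definite: "f \<in> H \<Longrightarrow> ip f f = 0 \<Longrightarrow> f = (\<lambda>x. 0)"
    and complete:
      "(\<And>n. F n \<in> H) \<Longrightarrow>
       (\<And>e. e > 0 \<Longrightarrow> \<exists>N. \<forall>m\<ge>N. \<forall>n\<ge>N.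
          sqrt (ip (\<lambda>x. F m x - F n x) (\<lambda>x. F m x - F n x)) < e) \<Longrightarrow>
       \<exists>f\<in>H. (\<lambda>n. sqrt (ip (\<lambda>x. F n x - f x) (\<lambda>x. F n x - f x))) \<longlonglongrightarrow> 0"
    and kernel_mem: "y \<in> D \<Longrightarrow> (\<lambda>x. if x \<in> D then K x y else 0) \<in> H"
    and reproducing: "f \<in> H \<Longrightarrow> y \<in> D \<Longrightarrow> ip f (\<lambda>x. if x \<in> D then K x y else 0) = f y"

definition worst_case_error ::
  "(real ^ 's \<Rightarrow> real) set \<Rightarrow> ((real ^ 's \<Rightarrow> real) \<Rightarrow> (real ^ 's \<Rightarrow> real) \<Rightarrow> real) \<Rightarrow>
   (real ^ 's) multiset \<Rightarrow> real" where
  "worst_case_error H ip P =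
     (SUP f\<in>{f \<in> H. sqrt (ip f f) \<le> 1}.
        \<bar>set_lebesgue_integral lborel unit_cube f - (\<Sum>x\<in>#P. f x) / real (size P)\<bar>)"

end

theory Submission
  imports Defs
begin

text \<open>
  The integration error is a functional on the space, and the square of its norm is obtained by
  applying it to both arguments of the kernel. Expand the kernel into characters of the group,
  \<open>K (\<pi> z) (\<pi> w) = (\<Sum>k l. K'(k, l) \<chi>\<^sub>k(z) \<chi>\<^sub>l(w)\<^sup>*)\<close> with Walsh coefficients \<open>K'(k, l)\<close>, where
  \<open>x\<^sup>*\<close> is the conjugate of \<open>x\<close>. Integration maps \<open>\<chi>\<^sub>k\<close> to 1 for \<open>k = 0\<close> and to 0 otherwise. Averaging over
  the net maps \<open>\<chi>\<^sub>k\<close> to the indicator of the dual net, and averaging over the shifts by constant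
  sequences maps it to the indicator of the indices with digit sums divisible by \<open>b\<close>
  (\<open>sum_char_symmetrized_net\<close>). The difference of the two functionals is therefore, up to sign, the
  indicator of the nonzero indices in the dual of the symmetrized net, which leaves the sum in
  the theorem.

  The expansion has to hold at every pair of points of the group and not merely almost everywhere:
  a symmetrized net can contain sequences that end in digits \<open>b - 1\<close> and project below 1. The Walsh
  functions use the other expansion of the projection, so they differ from the characters at such
  a sequence. It does hold (\<open>walsh_expansion\<close>),
  since \<open>K \<circ> \<pi>\<close> is continuous on the group. A partial sum over all indices with at most \<open>N\<close>
  digits is, by the Dirichlet kernel, the average of \<open>K\<close> over the points whose first \<open>N\<close>
  digits are prescribed, and these cells shrink to the projected point.

  To keep everything finite, the integral is replaced by the average over the grid of points
  with at most \<open>N\<close> digits, a Riemann sum (\<open>grid_average_tendsto_integral\<close>). The grid is itself a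
  digital net, so on characters this average is again an indicator function, that of the indices
  divisible by \<open>b ^ N\<close>. The grid average minus the net average is thus a finite combination of
  point evaluations. Such a combination is the inner product with an explicit element of the space,
  and the mutual inner products of these elements converge by dominated convergence in the Walsh
  series (\<open>error_gram_tendsto\<close>). A general fact on reproducing kernel Hilbert spaces
  (\<open>SUP_functional_power2\<close>) identifies their limit with the square of the worst-case error.
\<close>

section \<open>Expansions in base b\<close>

primrec digit_prefix :: "nat \<Rightarrow> (nat \<Rightarrow> nat) \<Rightarrow> nat \<Rightarrow> nat" where
  "digit_prefix b \<xi> 0 = 0"
| "digit_prefix b \<xi> (Suc N) = b * digit_prefix b \<xi> N + \<xi> N"

lemma sum_digits_eq_prefix:
  assumes "b \<ge> 2"
  shows "(\<Sum>i<N. real (\<xi> i) / real b ^ Suc i) = real (digit_prefix b \<xi> N) / real b ^ N"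
  using assms by (induction N) (auto simp: field_simps)

lemma digit_prefix_inj:
  assumes "\<And>i. \<xi> i < b" "\<And>i. \<eta> i < b"
    and "digit_prefix b \<xi> N = digit_prefix b \<eta> N" and "i < N"
  shows "\<xi> i = \<eta> i"
  using assms(3,4)
proof (induction N arbitrary: i)
  case (Suc N)
  have eq: "b * digit_prefix b \<xi> N + \<xi> N = b * digit_prefix b \<eta> N + \<eta> N"
    using Suc.prems(1) by simp
  have "\<xi> N = (b * digit_prefix b \<xi> N + \<xi> N) mod b" using assms(1)[of N] by simp
  also have "\<dots> = \<eta> N" unfolding eq using assms(2)[of N] by simp
  finally have 1: "\<xi> N = \<eta> N" .
  then have "digit_prefix b \<xi> N = digit_prefix b \<eta> N"
    using eq assms(1)[of N] by auto
  then show ?case using Suc 1 by (cases "i = N") auto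
qed simp

lemma digit_prefix_le_mono:
  assumes "b \<ge> 2"
  shows "incseq (\<lambda>N. real (digit_prefix b \<xi> N) / real b ^ N)"
  using assms by (intro incseq_SucI) (simp add: field_simps)

lemma digit_prefix_Suc_antimono:
  assumes "b \<ge> 2" and "\<And>i. \<xi> i < b"
  shows "decseq (\<lambda>N. (real (digit_prefix b \<xi> N) + 1) / real b ^ N)"
proof (intro decseq_SucI)
  fix N
  have "real (digit_prefix b \<xi> (Suc N)) + 1 \<le> real b * (real (digit_prefix b \<xi> N) + 1)"
    using assms(2)[of N] by (simp add: algebra_simps)
  then have "(real (digit_prefix b \<xi> (Suc N)) + 1) / real b ^ Suc N
      \<le> real b * (real (digit_prefix b \<xi> N) + 1) / real b ^ Suc N"
    by (rule divide_right_mono) simp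
  then show "(real (digit_prefix b \<xi> (Suc N)) + 1) / real b ^ Suc N
      \<le> (real (digit_prefix b \<xi> N) + 1) / real b ^ N"
    using assms(1) by simp
qed

lemma inverse_power_tendsto_0:
  assumes "b \<ge> (2::nat)"
  shows "(\<lambda>N. 1 / real b ^ N) \<longlonglongrightarrow> 0"
proof -
  have "(\<lambda>N. (1 / real b) ^ N) \<longlonglongrightarrow> 0"
    using assms by (intro LIMSEQ_power_zero) auto
  then show ?thesis by (simp add: power_divide)
qed

lemma expansion_sums:
  assumes "b \<ge> 2" and "\<And>i. \<xi> i < b"
  shows "(\<lambda>i. real (\<xi> i) / real b ^ Suc i) sums (\<Sum>i. real (\<xi> i) / real b ^ Suc i)"
proof -
  have "(\<Sum>i<N. real (\<xi> i) / real b ^ Suc i) \<le> 1" for N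
  proof -
    have "real (digit_prefix b \<xi> N) / real b ^ N \<le> (real (digit_prefix b \<xi> N) + 1) / real b ^ N"
      by (intro divide_right_mono) auto
    also have "\<dots> \<le> 1"
      using decseqD[OF digit_prefix_Suc_antimono[OF assms], of 0 N] by simp
    finally show ?thesis using sum_digits_eq_prefix[OF assms(1)] by simp
  qed
  then have "summable (\<lambda>i. real (\<xi> i) / real b ^ Suc i)"
    by (intro summableI_nonneg_bounded[where x = 1]) auto
  then show ?thesis by (rule summable_sums)
qed

text \<open>The value of an expansion is squeezed between an increasing and a decreasing sequence of
  fractions, which are determined by the prefixes and differ by \<open>1 / b ^ N\<close>. Hence the value
  determines the prefixes up to the choice between the two expansions of a b-adic rational, and
  points with a common prefix are close.\<close>

lemma prefix_tendsto:
  assumes "b \<ge> 2" and "(\<lambda>i. real (\<xi> i) / real b ^ Suc i) sums x"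
  shows "(\<lambda>N. real (digit_prefix b \<xi> N) / real b ^ N) \<longlonglongrightarrow> x"
  using assms(2) unfolding sums_def sum_digits_eq_prefix[OF assms(1)] .

lemma prefix_Suc_tendsto:
  assumes "b \<ge> 2" and "(\<lambda>i. real (\<xi> i) / real b ^ Suc i) sums x"
  shows "(\<lambda>N. (real (digit_prefix b \<xi> N) + 1) / real b ^ N) \<longlonglongrightarrow> x"
  using tendsto_add[OF prefix_tendsto[OF assms] inverse_power_tendsto_0[OF assms(1)]]
  by (simp add: add_divide_distrib)

lemma prefix_bounds:
  assumes "b \<ge> 2" and "\<And>i. \<xi> i < b" and "(\<lambda>i. real (\<xi> i) / real b ^ Suc i) sums x"
  shows "real (digit_prefix b \<xi> N) / real b ^ N \<le> x"
    and "x \<le> (real (digit_prefix b \<xi> N) + 1) / real b ^ N"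
  using incseq_le[OF digit_prefix_le_mono prefix_tendsto] decseq_ge[OF digit_prefix_Suc_antimono prefix_Suc_tendsto]
    assms by blast+

text \<open>A digit other than \<open>b - 1\<close> after position \<open>N\<close> makes the decreasing bounds drop strictly. This is
  what excludes the second expansion of a b-adic rational, and makes the prefix a floor.\<close>

lemma prefix_strict_bound:
  assumes "b \<ge> 2" and "\<And>i. \<xi> i < b" and "(\<lambda>i. real (\<xi> i) / real b ^ Suc i) sums x"
    and "infinite {i. \<xi> i \<noteq> b - 1}"
  shows "x < (real (digit_prefix b \<xi> N) + 1) / real b ^ N"
proof -
  obtain M where M: "M \<ge> N" "\<xi> M \<noteq> b - 1"
    using assms(4) unfolding infinite_nat_iff_unbounded_le by auto
  have "real (digit_prefix b \<xi> (Suc M)) + 1 < real b * (real (digit_prefix b \<xi> M) + 1)"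
    using M(2) assms(2)[of M] by (simp add: algebra_simps)
  then have "(real (digit_prefix b \<xi> (Suc M)) + 1) / real b ^ Suc M
      < real b * (real (digit_prefix b \<xi> M) + 1) / real b ^ Suc M"
    using assms(1) by (intro divide_strict_right_mono) auto
  then have "(real (digit_prefix b \<xi> (Suc M)) + 1) / real b ^ Suc M
      < (real (digit_prefix b \<xi> M) + 1) / real b ^ M"
    using assms(1) by simp
  moreover have "x \<le> (real (digit_prefix b \<xi> (Suc M)) + 1) / real b ^ Suc M"
    by (rule prefix_bounds(2)[OF assms(1-3)])
  moreover have "(real (digit_prefix b \<xi> M) + 1) / real b ^ M
      \<le> (real (digit_prefix b \<xi> N) + 1) / real b ^ N"
    using decseqD[OF digit_prefix_Suc_antimono[OF assms(1,2)] M(1)] .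
  ultimately show ?thesis by linarith
qed

lemma digit_prefix_eq_floor:
  assumes "b \<ge> 2" and "\<And>i. \<xi> i < b" and "(\<lambda>i. real (\<xi> i) / real b ^ Suc i) sums x"
    and "infinite {i. \<xi> i \<noteq> b - 1}"
  shows "int (digit_prefix b \<xi> N) = \<lfloor>real b ^ N * x\<rfloor>"
proof -
  have "real (digit_prefix b \<xi> N) \<le> real b ^ N * x"
    using prefix_bounds(1)[OF assms(1-3), of N] assms(1) by (simp add: field_simps)
  moreover have "real b ^ N * x < real (digit_prefix b \<xi> N) + 1"
    using prefix_strict_bound[OF assms, of N] assms(1) by (simp add: field_simps)
  ultimately show ?thesis by (intro floor_unique[symmetric]) auto
qed

lemma floor_expansion_exists:
  fixes x :: real
  assumes b: "b \<ge> 2" and x: "0 \<le> x" "x < 1"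
  shows "\<exists>\<xi>. (\<forall>i. \<xi> i < b) \<and> infinite {i. \<xi> i \<noteq> b - 1} \<and>
    (\<lambda>i. real (\<xi> i) / real b ^ Suc i) sums x"
proof -
  define f where "f N = nat \<lfloor>real b ^ N * x\<rfloor>" for N
  define \<xi> where "\<xi> i = f (Suc i) mod b" for i
  have lt: "\<xi> i < b" for i using b by (simp add: \<xi>_def)
  have fdiv: "f (Suc N) div b = f N" for N
  proof -
    have "\<lfloor>real b ^ Suc N * x\<rfloor> div int b = \<lfloor>(real b ^ Suc N * x) / real_of_int (int b)\<rfloor>"
      by (rule floor_divide_real_eq_div[symmetric]) simp
    also have "(real b ^ Suc N * x) / real_of_int (int b) = real b ^ N * x"
      using b by simp
    finally have "\<lfloor>real b ^ N * x\<rfloor> = \<lfloor>real b ^ Suc N * x\<rfloor> div int b" by simp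
    moreover have "0 \<le> \<lfloor>real b ^ Suc N * x\<rfloor>" using x by simp
    ultimately show ?thesis unfolding f_def by (simp only: nat_div_distrib) simp
  qed
  have pre: "digit_prefix b \<xi> N = f N" for N
  proof (induction N)
    case 0
    have "\<lfloor>x\<rfloor> = 0" using x by linarith
    then show ?case by (simp add: f_def)
  next
    case (Suc N)
    then show ?case
      using fdiv[of N] mult_div_mod_eq[of b "f (Suc N)"] by (simp add: \<xi>_def)
  qed
  have fle: "real (f N) \<le> real b ^ N * x" and flt: "real b ^ N * x < real (f N) + 1" for N
    using x by (auto simp: f_def)
  have lim: "(\<lambda>N. real (digit_prefix b \<xi> N) / real b ^ N) \<longlonglongrightarrow> x"
  proof (rule tendsto_sandwich[where f = "\<lambda>N. x - 1 / real b ^ N" and h = "\<lambda>N. x"])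
    show "\<forall>\<^sub>F N in sequentially. x - 1 / real b ^ N \<le> real (digit_prefix b \<xi> N) / real b ^ N"
    proof (intro always_eventually allI)
      fix N show "x - 1 / real b ^ N \<le> real (digit_prefix b \<xi> N) / real b ^ N"
      proof -
        have "x \<le> (real (f N) + 1) / real b ^ N"
          using flt[of N] b by (simp add: pos_le_divide_eq mult.commute)
        then show ?thesis by (simp add: pre add_divide_distrib)
      qed
    qed
    show "\<forall>\<^sub>F N in sequentially. real (digit_prefix b \<xi> N) / real b ^ N \<le> x"
    proof (intro always_eventually allI)
      fix N show "real (digit_prefix b \<xi> N) / real b ^ N \<le> x"
        using fle[of N] b by (simp add: pre field_simps)
    qed
    show "(\<lambda>N. x - 1 / real b ^ N) \<longlonglongrightarrow> x"
      using tendsto_diff[OF tendsto_const inverse_power_tendsto_0[OF b], of x] by simp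
  qed simp
  have sums: "(\<lambda>i. real (\<xi> i) / real b ^ Suc i) sums x"
    unfolding sums_def sum_digits_eq_prefix[OF b] by (rule lim)
  have "infinite {i. \<xi> i \<noteq> b - 1}"
  proof
    assume "finite {i. \<xi> i \<noteq> b - 1}"
    then obtain M where "\<forall>i\<in>{i. \<xi> i \<noteq> b - 1}. i < M"
      using finite_nat_set_iff_bounded by auto
    then have M: "\<xi> i = b - 1" if "i \<ge> M" for i using that by force
    \<comment> \<open>A tail of digits b - 1 makes the decreasing upper bounds constant, so x equals one
      of them; but the floor is strict there.\<close>
    have step: "(real (digit_prefix b \<xi> (M + n)) + 1) / real b ^ (M + n)
        = (real (digit_prefix b \<xi> M) + 1) / real b ^ M" for n
    proof (induction n)
      case (Suc n)
      have "\<xi> (M + n) + 1 = b" using M[of "M + n"] b by simp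
      then have "real (\<xi> (M + n)) = real b - 1" by linarith
      then have "real (digit_prefix b \<xi> (M + Suc n)) + 1
          = real b * (real (digit_prefix b \<xi> (M + n)) + 1)"
        by (simp add: algebra_simps)
      then have "(real (digit_prefix b \<xi> (M + Suc n)) + 1) / real b ^ (M + Suc n)
          = (real (digit_prefix b \<xi> (M + n)) + 1) / real b ^ (M + n)"
        using b by (simp del: digit_prefix.simps)
      then show ?case using Suc by simp
    qed simp
    have "(\<lambda>n. (real (digit_prefix b \<xi> (n + M)) + 1) / real b ^ (n + M)) \<longlonglongrightarrow> x"
      by (rule LIMSEQ_ignore_initial_segment[OF prefix_Suc_tendsto[OF b sums]])
    then have "(\<lambda>n::nat. (real (digit_prefix b \<xi> M) + 1) / real b ^ M) \<longlonglongrightarrow> x"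
      by (simp only: add.commute[of _ M] step)
    then have "x = (real (f M) + 1) / real b ^ M"
      using LIMSEQ_unique[OF _ tendsto_const] by (simp add: pre)
    then show False using flt[of M] b by simp
  qed
  then show ?thesis using lt sums by blast
qed

text \<open>The description in the definition of the digits of \<open>x < 1\<close> is unique because the prefixes of such
  an expansion are \<open>\<lfloor>b ^ N * x\<rfloor>\<close>. The constant digits chosen at 1 are the only expansion of 1.\<close>

lemma real_digits_expansion:
  fixes x :: real
  assumes b: "b \<ge> 2" and x: "0 \<le> x" "x \<le> 1"
  shows "(\<forall>i. real_digits b x i < b) \<and> (\<lambda>i. real (real_digits b x i) / real b ^ Suc i) sums x"
proof (cases "x = 1")
  case True
  have "digit_prefix b (\<lambda>i. b - 1) N + 1 = b ^ N" for N
  proof (induction N)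
    case (Suc N)
    have "digit_prefix b (\<lambda>i. b - 1) (Suc N) + 1 = b * (digit_prefix b (\<lambda>i. b - 1) N + 1)"
      using b by (simp add: algebra_simps)
    then show ?case unfolding Suc by simp
  qed simp
  then have "real (digit_prefix b (\<lambda>i. b - 1) N) + 1 = real b ^ N" for N
    by (metis of_nat_1 of_nat_add of_nat_power)
  then have "real (digit_prefix b (\<lambda>i. b - 1) N) / real b ^ N = 1 - 1 / real b ^ N" for N
  proof -
    have "real (digit_prefix b (\<lambda>i. b - 1) N) = real b ^ N - 1"
      using \<open>\<And>N. real (digit_prefix b (\<lambda>i. b - 1) N) + 1 = real b ^ N\<close>[of N] by linarith
    then show ?thesis using b by (simp add: diff_divide_distrib)
  qed
  then have "(\<lambda>N. real (digit_prefix b (\<lambda>i. b - 1) N) / real b ^ N) \<longlonglongrightarrow> 1"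
    using tendsto_diff[OF tendsto_const inverse_power_tendsto_0[OF b], of 1] by simp
  then have "(\<lambda>i. real (b - 1) / real b ^ Suc i) sums 1"
    unfolding sums_def using sum_digits_eq_prefix[OF b, of "\<lambda>i. b - 1"] by simp
  then show ?thesis using True b by (simp add: real_digits_def)
next
  case False
  then have x1: "x < 1" using x by simp
  let ?P = "\<lambda>\<xi>. (\<forall>i. \<xi> i < b) \<and> infinite {i. \<xi> i \<noteq> b - 1} \<and>
    (\<lambda>i. real (\<xi> i) / real b ^ Suc i) sums x"
  have "\<exists>!\<xi>. ?P \<xi>"
  proof (rule ex_ex1I)
    show "\<exists>\<xi>. ?P \<xi>" by (rule floor_expansion_exists[OF b x(1) x1])
    fix \<xi> \<eta> assume A: "?P \<xi>" "?P \<eta>"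
    have "int (digit_prefix b \<xi> N) = int (digit_prefix b \<eta> N)" for N
      using digit_prefix_eq_floor[OF b, of \<xi> x N] digit_prefix_eq_floor[OF b, of \<eta> x N] A by simp
    then have pre: "digit_prefix b \<xi> N = digit_prefix b \<eta> N" for N by simp
    show "\<xi> = \<eta>"
    proof
      fix i show "\<xi> i = \<eta> i"
        by (rule digit_prefix_inj[OF _ _ pre[of "Suc i"]]) (use A in auto)
    qed
  qed
  from theI'[OF this] show ?thesis using False by (simp add: real_digits_def)
qed

section \<open>Walsh characters and their averages\<close>

text \<open>The Walsh functions are characters of the group evaluated at digit sequences. The characters
  themselves are defined at every digit sequence, also at those that the Walsh functions never see.\<close>

definition char1 :: "nat \<Rightarrow> nat \<Rightarrow> (nat \<Rightarrow> nat) \<Rightarrow> complex" where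
  "char1 b k z = omega b ^ (\<Sum>i\<in>digit_supp b k. nat_digit b k i * z i)"

definition char_G :: "nat \<Rightarrow> nat ^ 's \<Rightarrow> (nat \<Rightarrow> nat) ^ 's \<Rightarrow> complex" where
  "char_G b k z = (\<Prod>j\<in>UNIV. char1 b (k $ j) (z $ j))"

lemma norm_omega [simp]: "norm (omega b) = 1"
proof -
  have "omega b = cis (2 * pi / real b)"
    by (simp add: omega_def cis_conv_exp mult_ac)
  then show ?thesis by simp
qed

lemma omega_power_eq_1_iff:
  assumes "b \<ge> 2"
  shows "omega b ^ n = 1 \<longleftrightarrow> b dvd n"
proof -
  have "omega b ^ n = exp (of_nat n * (2 * of_real pi * \<i> / of_nat b))"
    unfolding omega_def by (rule exp_of_nat_mult[symmetric])
  also have "of_nat n * (2 * of_real pi * \<i> / of_nat b) = 2 * of_real pi * \<i> * of_nat n / (of_nat b :: complex)"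
    by simp
  finally show ?thesis using complex_root_unity_eq_1[of b n] assms by simp
qed

lemma omega_power_mod:
  assumes "b \<ge> 2"
  shows "omega b ^ (n mod b) = omega b ^ n"
proof -
  have "omega b ^ n = omega b ^ (b * (n div b) + n mod b)" by simp
  also have "\<dots> = (omega b ^ b) ^ (n div b) * omega b ^ (n mod b)"
    by (simp only: power_add power_mult)
  also have "omega b ^ b = 1" using omega_power_eq_1_iff[OF assms, of b] by simp
  finally show ?thesis by simp
qed

lemma cnj_omega:
  assumes "b \<ge> 2"
  shows "cnj (omega b) = omega b ^ (b - 1)"
proof -
  have "omega b * cnj (omega b) = 1"
    by (simp add: complex_norm_square[symmetric])
  moreover have "omega b * omega b ^ (b - 1) = 1"
    using omega_power_eq_1_iff[OF assms, of b] assms by (simp flip: power_Suc)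
  moreover have "omega b \<noteq> 0" using norm_omega[of b] by (metis norm_zero zero_neq_one)
  ultimately show ?thesis by (metis mult_cancel_left)
qed

lemma sum_omega_powers:
  assumes "b \<ge> 2"
  shows "(\<Sum>a<b. omega b ^ (a * c)) = (if b dvd c then of_nat b else 0)"
proof -
  have "(\<Sum>a<b. omega b ^ (a * c)) = (\<Sum>a<b. (omega b ^ c) ^ a)"
    by (simp add: power_mult[symmetric] mult.commute)
  also have "\<dots> = (if b dvd c then of_nat b else 0)"
  proof (cases "b dvd c")
    case True
    then show ?thesis using omega_power_eq_1_iff[OF assms, of c] by simp
  next
    case False
    then have ne: "omega b ^ c \<noteq> 1" using omega_power_eq_1_iff[OF assms, of c] by simp
    have "(omega b ^ c) ^ b = 1"
      unfolding power_mult[symmetric] using omega_power_eq_1_iff[OF assms, of "c * b"] by simp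
    then show ?thesis using geometric_sum[OF ne, of b] False by simp
  qed
  finally show ?thesis .
qed

text \<open>Conjugation is rewritten as the power \<open>b - 1\<close>, which turns the orthogonality relation into a
  single sum of powers, with the exponent congruent to \<open>z - w\<close>.\<close>

lemma sum_omega_orthogonal:
  assumes "b \<ge> 2" and "z < b" and "w < b"
  shows "(\<Sum>a<b. omega b ^ (a * z) * cnj (omega b ^ (a * w))) = (if z = w then of_nat b else 0)"
proof -
  have "omega b ^ (a * z) * cnj (omega b ^ (a * w)) = omega b ^ (a * (z + (b - 1) * w))" for a
    by (simp add: cnj_omega[OF assms(1)] power_mult[symmetric] power_add[symmetric] algebra_simps)
  then have "(\<Sum>a<b. omega b ^ (a * z) * cnj (omega b ^ (a * w)))
      = (if b dvd z + (b - 1) * w then of_nat b else 0)"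
    using sum_omega_powers[OF assms(1), of "z + (b - 1) * w"] by simp
  also have "b dvd z + (b - 1) * w \<longleftrightarrow> z = w"
  proof -
    have "int (b - 1) = int b - 1" using assms(1) by simp
    then have "int (z + (b - 1) * w) = int z - int w + int b * int w"
      by (simp add: left_diff_distrib)
    then have "b dvd z + (b - 1) * w \<longleftrightarrow> int b dvd int z - int w"
      by (metis dvd_add_left_iff dvd_triv_left int_dvd_int_iff)
    also have "\<dots> \<longleftrightarrow> z = w"
    proof
      assume "int b dvd int z - int w"
      then show "z = w" using dvd_imp_le_int[of "int z - int w" "int b"] assms by fastforce
    qed simp
    finally show ?thesis .
  qed
  finally show ?thesis .
qed

lemma nat_digit_less: "b \<ge> 2 \<Longrightarrow> nat_digit b k i < b"
  by (simp add: nat_digit_def)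

lemma nat_digit_eq_0:
  assumes "b \<ge> 2" and "k < b ^ N" and "N \<le> i"
  shows "nat_digit b k i = 0"
proof -
  have "k < b ^ i"
    using assms power_increasing[of N i b] by linarith
  then show ?thesis by (simp add: nat_digit_def)
qed

lemma digit_supp_subset:
  assumes "b \<ge> 2" and "k < b ^ N"
  shows "digit_supp b k \<subseteq> {..<N}"
proof
  fix i assume "i \<in> digit_supp b k"
  then show "i \<in> {..<N}" using nat_digit_eq_0[OF assms, of i] by (cases "N \<le> i") (auto simp: digit_supp_def)
qed

lemma nat_less_base_power: "b \<ge> (2::nat) \<Longrightarrow> k < b ^ k"
  by (simp add: power_gt_expt)

lemma finite_digit_supp [simp]: "b \<ge> 2 \<Longrightarrow> finite (digit_supp b k)"
  using digit_supp_subset[OF _ nat_less_base_power] finite_subset by blast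

lemma char1_eq_prod:
  "char1 b k z = (\<Prod>i\<in>digit_supp b k. omega b ^ (nat_digit b k i * z i))"
  unfolding char1_def by (rule power_sum)

lemma char1_eq_prod_less:
  assumes "b \<ge> 2" and "k < b ^ N"
  shows "char1 b k z = (\<Prod>i<N. omega b ^ (nat_digit b k i * z i))"
  unfolding char1_eq_prod using digit_supp_subset[OF assms]
  by (intro prod.mono_neutral_left) (auto simp: digit_supp_def)

lemma norm_char_G [simp]: "norm (char_G b k z) = 1"
  by (simp add: char_G_def char1_def norm_power prod_norm[symmetric])

lemma wal_eq_char_G: "wal b k x = char_G b k (\<chi> j. real_digits b (x $ j))"
  by (simp add: wal_def char_G_def wal1_def char1_def)

lemma char_G_add:
  assumes "b \<ge> 2"
  shows "char_G b k (add_G b z w) = char_G b k z * char_G b k w"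
proof -
  have "omega b ^ (d * ((x + y) mod b)) = omega b ^ (d * x) * omega b ^ (d * y)" for d x y
    by (metis (no_types) omega_power_mod[OF assms] distrib_left mod_mult_right_eq power_add)
  then show ?thesis
    by (simp add: char_G_def char1_eq_prod add_G_def prod.distrib)
qed

lemma char_G_const: "char_G b k (const_G l) = (\<Prod>j\<in>UNIV. omega b ^ (l $ j * digit_sum b (k $ j)))"
  by (simp add: char_G_def char1_def const_G_def digit_sum_def sum_distrib_left mult.commute)

text \<open>Summing over all numbers with at most N digits is summing over the digits
  independently. This turns every average of characters below into a product of sums of roots
  of unity.\<close>

lemma sum_prod_digits:
  fixes f :: "nat \<Rightarrow> nat \<Rightarrow> 'a :: comm_semiring_1"
  assumes "b \<ge> 2"
  shows "(\<Sum>k<b ^ N. \<Prod>i<N. f i (nat_digit b k i)) = (\<Prod>i<N. \<Sum>a<b. f i a)"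
proof (induction N)
  case (Suc N)
  let ?g = "\<lambda>k. \<Prod>i<Suc N. f i (nat_digit b k i)"
  have top: "nat_digit b (q + a * b ^ N) N = a" if "q < b ^ N" "a < b" for q a
    using that assms by (simp add: nat_digit_def)
  have low: "nat_digit b (q + a * b ^ N) i = nat_digit b q i" if "i < N" for q a i
  proof -
    have "b ^ N = b ^ i * (b * b ^ (N - Suc i))"
      using that by (simp flip: power_Suc power_add add: Suc_diff_Suc)
    then have "q + a * b ^ N = q + b ^ i * (b * (a * b ^ (N - Suc i)))"
      by (simp add: mult_ac)
    then have "(q + a * b ^ N) div b ^ i = b * (a * b ^ (N - Suc i)) + q div b ^ i"
      using assms by (metis add.commute div_mult_self2 not_numeral_le_zero power_not_zero)
    then show ?thesis by (simp add: nat_digit_def)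
  qed
  have "(\<Sum>k<b ^ Suc N. ?g k) = (\<Sum>a<b. sum ?g {a * b ^ N ..< a * b ^ N + b ^ N})"
    using sum.nat_group[of ?g "b ^ N" b] by (simp add: mult.commute)
  also have "\<dots> = (\<Sum>a<b. \<Sum>q<b ^ N. ?g (q + a * b ^ N))"
  proof (rule sum.cong[OF refl])
    fix a show "sum ?g {a * b ^ N ..< a * b ^ N + b ^ N} = (\<Sum>q<b ^ N. ?g (q + a * b ^ N))"
      using sum.shift_bounds_nat_ivl[of ?g 0 "a * b ^ N" "b ^ N"]
      by (simp only: add_0 atLeast0LessThan add.commute[of "b ^ N"])
  qed
  also have "\<dots> = (\<Sum>a<b. \<Sum>q<b ^ N. (\<Prod>i<N. f i (nat_digit b q i)) * f N a)"
    by (intro sum.cong refl) (simp add: top low)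
  also have "\<dots> = (\<Sum>q<b ^ N. \<Prod>i<N. f i (nat_digit b q i)) * (\<Sum>a<b. f N a)"
    by (subst sum.swap) (simp add: sum_product)
  finally show ?case using Suc by simp
qed simp

lemma sum_prod_vec:
  fixes f :: "'s::finite \<Rightarrow> 'b \<Rightarrow> 'c :: comm_semiring_1"
  assumes "\<And>j. finite (A j)"
  shows "(\<Sum>l\<in>{l. \<forall>j. l $ j \<in> A j}. \<Prod>j\<in>UNIV. f j (l $ j)) = (\<Prod>j\<in>UNIV. \<Sum>a\<in>A j. f j a)"
proof -
  have "(\<Sum>l\<in>{l. \<forall>j. l $ j \<in> A j}. \<Prod>j\<in>UNIV. f j (l $ j))
      = (\<Sum>g\<in>PiE UNIV A. \<Prod>j\<in>UNIV. f j (g j))"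
    by (rule sum.reindex_bij_witness[of _ vec_lambda vec_nth]) (auto simp: PiE_UNIV_domain)
  then show ?thesis using prod_sum_PiE[of UNIV A f] assms by simp
qed

lemma prod_if_const:
  assumes "finite A"
  shows "(\<Prod>j\<in>A. if P j then c else (0 :: 'a :: comm_semiring_1)) = (if \<forall>j\<in>A. P j then c ^ card A else 0)"
  using assms by (induction A rule: finite_induct) auto

lemma prod_prod_if_const:
  "(\<Prod>j\<in>(UNIV :: 's::finite set). \<Prod>i<N. if P j i then c else (0 :: 'a :: comm_semiring_1))
    = (if \<forall>j. \<forall>i<N. P j i then c ^ (N * CARD('s)) else 0)"
  by (simp only: prod_if_const finite_lessThan finite_UNIV finite card_lessThan power_mult Ball_def
      UNIV_I lessThan_iff simp_thms)

definition index_box :: "nat \<Rightarrow> nat \<Rightarrow> (nat ^ 's) set" where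
  "index_box b N = {k. \<forall>j. k $ j < b ^ N}"

lemma card_vec_less:
  "finite {l :: nat ^ 's::finite. \<forall>j. l $ j < n} \<and>
   card {l :: nat ^ 's::finite. \<forall>j. l $ j < n} = n ^ CARD('s)"
proof
  have "{l :: nat ^ 's. \<forall>j. l $ j < n} \<subseteq> vec_lambda ` (PiE UNIV (\<lambda>_. {..<n}))"
    by (intro subsetI image_eqI[where x = "vec_nth _"]) (auto simp: PiE_UNIV_domain)
  then show "finite {l :: nat ^ 's. \<forall>j. l $ j < n}"
    by (rule finite_subset) (auto intro!: finite_PiE)
  show "card {l :: nat ^ 's. \<forall>j. l $ j < n} = n ^ CARD('s)"
    using sum_prod_vec[of "\<lambda>_ :: 's. {..<n}" "\<lambda>_ _. 1 :: nat"] by simp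
qed

lemma finite_index_box [simp]: "finite (index_box b N)"
  and card_index_box: "card (index_box b N :: (nat ^ 's::finite) set) = b ^ (N * CARD('s))"
  using card_vec_less[of "b ^ N"] by (auto simp: index_box_def power_mult)

text \<open>Seen as a function of one point, the kernel is a multiple of the indicator of the points that
  share the first \<open>N\<close> digits with the other. It recovers the values of a function from its Walsh
  coefficients, as the partial sums of a Walsh series are averages over such sets.\<close>

lemma dirichlet_kernel:
  fixes z w :: "(nat \<Rightarrow> nat) ^ 's::finite"
  assumes b: "b \<ge> 2" and z: "\<And>i j. (z $ j) i < b" and w: "\<And>i j. (w $ j) i < b"
  shows "(\<Sum>k\<in>index_box b N. char_G b k z * cnj (char_G b k w))
    = (if \<forall>j. \<forall>i<N. (z $ j) i = (w $ j) i then of_nat (b ^ (N * CARD('s))) else 0)"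
proof -
  have "(\<Sum>k\<in>index_box b N. char_G b k z * cnj (char_G b k w))
      = (\<Sum>k\<in>{k. \<forall>j::'s. k $ j \<in> {..<b ^ N}}.
          \<Prod>j\<in>UNIV. char1 b (k $ j) (z $ j) * cnj (char1 b (k $ j) (w $ j)))"
    by (simp add: index_box_def char_G_def prod.distrib)
  also have "\<dots> = (\<Prod>j\<in>UNIV. \<Sum>k<b ^ N. char1 b k (z $ j) * cnj (char1 b k (w $ j)))"
    by (rule sum_prod_vec) simp
  also have "\<dots> = (\<Prod>j\<in>UNIV. \<Sum>k<b ^ N. \<Prod>i<N.
      omega b ^ (nat_digit b k i * (z $ j) i) * cnj (omega b ^ (nat_digit b k i * (w $ j) i)))"
    by (intro prod.cong sum.cong refl) (simp add: char1_eq_prod_less[OF b] prod.distrib)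
  also have "\<dots> = (\<Prod>j\<in>UNIV. \<Prod>i<N. \<Sum>a<b.
      omega b ^ (a * (z $ j) i) * cnj (omega b ^ (a * (w $ j) i)))"
    by (intro prod.cong refl sum_prod_digits[OF b, where f = "\<lambda>i a. omega b ^ (a * (z $ _) i) * cnj (omega b ^ (a * (w $ _) i))"])
  also have "\<dots> = (\<Prod>j\<in>UNIV. \<Prod>i<N. if (z $ j) i = (w $ j) i then of_nat b else 0)"
    by (intro prod.cong refl sum_omega_orthogonal b z w)
  also have "\<dots> = (if \<forall>j. \<forall>i<N. (z $ j) i = (w $ j) i then of_nat (b ^ (N * CARD('s))) else 0)"
    by (simp only: prod_prod_if_const of_nat_power)
  finally show ?thesis .
qed

text \<open>The digits of the index are used in reversed order, as the least significant one becomes the leading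
  digit of the point. Only the set of grid points matters, and it consists of all digit sequences
  that vanish from position \<open>N\<close> on. It is itself a digital net, whose dual consists of the indices
  with all components divisible by \<open>b ^ N\<close>.\<close>

definition grid_point :: "nat \<Rightarrow> nat \<Rightarrow> nat ^ 's \<Rightarrow> (nat \<Rightarrow> nat) ^ 's" where
  "grid_point b N a = (\<chi> j. (\<lambda>i. if i < N then nat_digit b (a $ j) i else 0))"

lemma sum_char_grid:
  fixes k :: "nat ^ 's::finite"
  assumes b: "b \<ge> 2"
  shows "(\<Sum>a\<in>index_box b N. char_G b k (grid_point b N a))
    = (if \<forall>j. \<forall>i<N. nat_digit b (k $ j) i = 0 then of_nat (b ^ (N * CARD('s))) else 0)"
proof -
  have c: "char1 b d (\<lambda>i. if i < N then nat_digit b a i else 0)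
      = (\<Prod>i<N. omega b ^ (nat_digit b a i * nat_digit b d i))" for d a
  proof -
    have "(\<Sum>i\<in>digit_supp b d. nat_digit b d i * (if i < N then nat_digit b a i else 0))
        = (\<Sum>i\<in>digit_supp b d \<inter> {..<N}. nat_digit b a i * nat_digit b d i)"
      using b by (intro sum.mono_neutral_cong_right) (auto simp: mult.commute)
    also have "\<dots> = (\<Sum>i<N. nat_digit b a i * nat_digit b d i)"
      by (intro sum.mono_neutral_left) (auto simp: digit_supp_def)
    finally show ?thesis by (simp add: char1_def power_sum)
  qed
  have "(\<Sum>a\<in>index_box b N. char_G b k (grid_point b N a))
      = (\<Sum>a\<in>{a. \<forall>j::'s. a $ j \<in> {..<b ^ N}}.
          \<Prod>j\<in>UNIV. \<Prod>i<N. omega b ^ (nat_digit b (a $ j) i * nat_digit b (k $ j) i))"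
    by (simp add: index_box_def char_G_def grid_point_def c)
  also have "\<dots> = (\<Prod>j\<in>UNIV. \<Sum>a<b ^ N. \<Prod>i<N. omega b ^ (nat_digit b a i * nat_digit b (k $ j) i))"
    by (rule sum_prod_vec) simp
  also have "\<dots> = (\<Prod>j\<in>UNIV. \<Prod>i<N. \<Sum>a<b. omega b ^ (a * nat_digit b (k $ j) i))"
    by (intro prod.cong refl sum_prod_digits[OF b, where f = "\<lambda>i a. omega b ^ (a * nat_digit b (k $ _) i)"])
  also have "\<dots> = (\<Prod>j\<in>UNIV. \<Prod>i<N. if nat_digit b (k $ j) i = 0 then of_nat b else 0)"
  proof (intro prod.cong refl)
    fix j i
    have "b dvd nat_digit b (k $ j) i \<longleftrightarrow> nat_digit b (k $ j) i = 0"
      using nat_digit_less[OF b, of "k $ j" i] by (auto dest: dvd_imp_le)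
    then show "(\<Sum>a<b. omega b ^ (a * nat_digit b (k $ j) i))
        = (if nat_digit b (k $ j) i = 0 then of_nat b else 0)"
      using sum_omega_powers[OF b] by simp
  qed
  also have "\<dots> = (if \<forall>j. \<forall>i<N. nat_digit b (k $ j) i = 0 then of_nat (b ^ (N * CARD('s))) else 0)"
    by (simp only: prod_prod_if_const of_nat_power)
  finally show ?thesis .
qed

text \<open>A character at the point with index \<open>n\<close> is a product over the columns of the matrices: the digit
  of \<open>n\<close> for column \<open>r\<close> multiplies the entry \<open>r\<close> of the vector \<open>k\<^sub>1 C\<^sub>1 + \<dots> + k\<^sub>s C\<^sub>s\<close>. The sum
  over the digit vanishes unless that entry is 0 modulo \<open>b\<close>.\<close>

lemma sum_char_net:
  fixes C :: "'s::finite \<Rightarrow> nat \<Rightarrow> nat \<Rightarrow> nat"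
  assumes b: "b \<ge> 2"
  shows "(\<Sum>n<b ^ m. char_G b k (net_point b m C n))
    = (if k \<in> dual_net b m C then of_nat (b ^ m) else 0)"
proof -
  define c where "c r = (\<Sum>j\<in>UNIV. \<Sum>i\<in>digit_supp b (k $ j). nat_digit b (k $ j) i * C j i r)" for r
  have "char_G b k (net_point b m C n) = (\<Prod>r<m. omega b ^ (nat_digit b n r * c r))" for n
  proof -
    have md: "omega b ^ (d * (x mod b)) = omega b ^ (d * x)" for d x
      by (metis (no_types) omega_power_mod[OF b] mod_mult_right_eq)
    have "char_G b k (net_point b m C n) = (\<Prod>j\<in>UNIV. \<Prod>i\<in>digit_supp b (k $ j).
        omega b ^ (nat_digit b (k $ j) i * (\<Sum>r<m. nat_digit b n r * C j i r)))"
      by (simp add: char_G_def char1_eq_prod net_point_def md)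
    also have "\<dots> = omega b ^ (\<Sum>j\<in>UNIV. \<Sum>i\<in>digit_supp b (k $ j).
        nat_digit b (k $ j) i * (\<Sum>r<m. nat_digit b n r * C j i r))"
      by (simp add: power_sum)
    also have "(\<Sum>j\<in>UNIV. \<Sum>i\<in>digit_supp b (k $ j).
        nat_digit b (k $ j) i * (\<Sum>r<m. nat_digit b n r * C j i r))
      = (\<Sum>j\<in>UNIV. \<Sum>i\<in>digit_supp b (k $ j). \<Sum>r<m. nat_digit b n r * (nat_digit b (k $ j) i * C j i r))"
      by (simp add: sum_distrib_left mult_ac)
    also have "\<dots> = (\<Sum>j\<in>UNIV. \<Sum>r<m. \<Sum>i\<in>digit_supp b (k $ j). nat_digit b n r * (nat_digit b (k $ j) i * C j i r))"
      by (intro sum.cong refl sum.swap)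
    also have "\<dots> = (\<Sum>r<m. \<Sum>j\<in>UNIV. \<Sum>i\<in>digit_supp b (k $ j). nat_digit b n r * (nat_digit b (k $ j) i * C j i r))"
      by (rule sum.swap)
    also have "\<dots> = (\<Sum>r<m. nat_digit b n r * c r)"
      by (simp add: c_def sum_distrib_left)
    finally show ?thesis by (simp add: power_sum)
  qed
  then have "(\<Sum>n<b ^ m. char_G b k (net_point b m C n))
      = (\<Sum>n<b ^ m. \<Prod>r<m. omega b ^ (nat_digit b n r * c r))" by simp
  also have "\<dots> = (\<Prod>r<m. \<Sum>a<b. omega b ^ (a * c r))"
    by (rule sum_prod_digits[OF b])
  also have "\<dots> = (if k \<in> dual_net b m C then of_nat (b ^ m) else 0)"
  proof -
    have "k \<in> dual_net b m C \<longleftrightarrow> (\<forall>r\<in>{..<m}. b dvd c r)"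
      by (auto simp: dual_net_def c_def[symmetric] dvd_eq_mod_eq_0)
    then show ?thesis by (simp only: sum_omega_powers[OF b] prod_if_const finite_lessThan card_lessThan of_nat_power)
  qed
  finally show ?thesis .
qed

text \<open>A constant sequence \<open>(l, l, \<dots>)\<close> sees only the digit sum of an index, so averaging over all
  such shifts keeps the indices whose digit sums are divisible by \<open>b\<close>.\<close>

lemma sum_char_shifts:
  fixes k :: "nat ^ 's::finite"
  assumes b: "b \<ge> 2"
  shows "(\<Sum>l\<in>{l. \<forall>j. l $ j < b}. char_G b k (const_G l))
    = (if \<forall>j. k $ j \<in> E_set b then of_nat (b ^ CARD('s)) else 0)"
proof -
  have "(\<Sum>l\<in>{l. \<forall>j. l $ j < b}. char_G b k (const_G l))
      = (\<Sum>l\<in>{l. \<forall>j::'s. l $ j \<in> {..<b}}. \<Prod>j\<in>UNIV. omega b ^ (l $ j * digit_sum b (k $ j)))"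
    by (simp add: char_G_const)
  also have "\<dots> = (\<Prod>j\<in>UNIV. \<Sum>a<b. omega b ^ (a * digit_sum b (k $ j)))"
    by (rule sum_prod_vec) simp
  also have "\<dots> = (if \<forall>j. k $ j \<in> E_set b then of_nat (b ^ CARD('s)) else 0)"
    by (simp add: sum_omega_powers[OF b] prod_if_const E_set_def dvd_eq_mod_eq_0)
  finally show ?thesis .
qed

lemma sum_char_symmetrized_net:
  fixes C :: "'s::finite \<Rightarrow> nat \<Rightarrow> nat \<Rightarrow> nat"
  assumes b: "b \<ge> 2"
  shows "(\<Sum>(n, l)\<in>{..<b ^ m} \<times> {l. \<forall>j. l $ j < b}.
      char_G b k (add_G b (net_point b m C n) (const_G l)))
    = (if k \<in> dual_net b m C \<inter> {k. \<forall>j. k $ j \<in> E_set b} then of_nat (b ^ m * b ^ CARD('s)) else 0)"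
proof -
  have "(\<Sum>(n, l)\<in>{..<b ^ m} \<times> {l. \<forall>j. l $ j < b}.
      char_G b k (add_G b (net_point b m C n) (const_G l)))
    = (\<Sum>n<b ^ m. char_G b k (net_point b m C n)) * (\<Sum>l\<in>{l. \<forall>j. l $ j < b}. char_G b k (const_G l))"
    by (simp add: sum.cartesian_product[symmetric] char_G_add[OF b] sum_product)
  then show ?thesis by (simp add: sum_char_net[OF b] sum_char_shifts[OF b])
qed

section \<open>Cells of points with given leading digits\<close>

definition cell1 :: "nat \<Rightarrow> nat \<Rightarrow> (nat \<Rightarrow> nat) \<Rightarrow> real set" where
  "cell1 b N \<zeta> = {x \<in> {0..1}. \<forall>i<N. real_digits b x i = \<zeta> i}"

lemma digit_prefix_cong:
  "(\<And>i. i < N \<Longrightarrow> \<xi> i = \<eta> i) \<Longrightarrow> digit_prefix b \<xi> N = digit_prefix b \<eta> N"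
  by (induction N) auto

lemma cell1_subset:
  assumes b: "b \<ge> 2" and x: "x \<in> cell1 b N \<zeta>"
  shows "real (digit_prefix b \<zeta> N) / real b ^ N \<le> x \<and>
    x \<le> (real (digit_prefix b \<zeta> N) + 1) / real b ^ N"
proof -
  have "digit_prefix b (real_digits b x) N = digit_prefix b \<zeta> N"
    using x by (intro digit_prefix_cong) (simp add: cell1_def)
  then show ?thesis
    using real_digits_expansion[OF b, of x] x prefix_bounds[OF b, of "real_digits b x" x N]
    by (simp add: cell1_def)
qed

text \<open>Only the open interval is contained in the cell: whether an endpoint belongs to it depends on
  which expansion is chosen there. This is enough to find the cell up to a null set.\<close>

lemma cell1_superset:
  assumes b: "b \<ge> 2" and \<zeta>: "\<And>i. \<zeta> i < b"
    and x: "real (digit_prefix b \<zeta> N) / real b ^ N < x"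
      "x < (real (digit_prefix b \<zeta> N) + 1) / real b ^ N"
  shows "x \<in> cell1 b N \<zeta>"
proof -
  let ?p = "digit_prefix b \<zeta> N" and ?q = "digit_prefix b (real_digits b x) N"
  have "0 \<le> real ?p / real b ^ N" by simp
  moreover have "(real ?p + 1) / real b ^ N \<le> 1"
    using decseqD[OF digit_prefix_Suc_antimono[OF b], of \<zeta> 0 N] \<zeta> by simp
  ultimately have x01: "0 \<le> x" "x \<le> 1" using x by linarith+
  have d: "\<And>i. real_digits b x i < b" "(\<lambda>i. real (real_digits b x i) / real b ^ Suc i) sums x"
    using real_digits_expansion[OF b x01] by auto
  have "real ?q / real b ^ N < (real ?p + 1) / real b ^ N"
    and "real ?p / real b ^ N < (real ?q + 1) / real b ^ N"
    using prefix_bounds[OF b d, of N] x by linarith+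
  then have "real ?q < real ?p + 1" "real ?p < real ?q + 1"
    using b by (simp_all add: divide_less_cancel)
  then have "?q = ?p" by linarith
  from digit_prefix_inj[OF d(1) \<zeta> this] show ?thesis
    using x01 by (simp add: cell1_def)
qed

text \<open>The cell differs from an open interval by a set of at most two points.\<close>

lemma cell1_borel:
  assumes b: "b \<ge> 2" and \<zeta>: "\<And>i. \<zeta> i < b"
  shows "cell1 b N \<zeta> \<in> sets borel"
proof -
  let ?l = "real (digit_prefix b \<zeta> N) / real b ^ N"
  let ?u = "(real (digit_prefix b \<zeta> N) + 1) / real b ^ N"
  have "cell1 b N \<zeta> = {?l<..<?u} \<union> (cell1 b N \<zeta> \<inter> {?l, ?u})"
  proof (intro equalityI subsetI)
    fix x assume x: "x \<in> cell1 b N \<zeta>"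
    show "x \<in> {?l<..<?u} \<union> (cell1 b N \<zeta> \<inter> {?l, ?u})"
      using cell1_subset[OF b x] x by auto
  next
    fix x assume "x \<in> {?l<..<?u} \<union> (cell1 b N \<zeta> \<inter> {?l, ?u})"
    then show "x \<in> cell1 b N \<zeta>" using cell1_superset[where \<zeta> = \<zeta>, OF b \<zeta>] by auto
  qed
  moreover have "finite (cell1 b N \<zeta> \<inter> {?l, ?u})" by simp
  then have "cell1 b N \<zeta> \<inter> {?l, ?u} \<in> sets borel"
    using borel_closed finite_imp_closed by blast
  ultimately show ?thesis
    by (metis sets.Un borel_open open_greaterThanLessThan)
qed

definition cell :: "nat \<Rightarrow> nat \<Rightarrow> (nat \<Rightarrow> nat) ^ 's \<Rightarrow> (real ^ 's) set" where
  "cell b N z = {x. \<forall>j. x $ j \<in> cell1 b N (z $ j)}"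

lemma mem_unit_cube: "x \<in> unit_cube \<longleftrightarrow> (\<forall>j. 0 \<le> x $ j \<and> x $ j \<le> 1)"
  by (simp add: mem_box_cart)

lemma cell_subset_cube: "cell b N z \<subseteq> unit_cube"
  by (auto simp: cell_def cell1_def mem_unit_cube)

lemma mem_cell_iff:
  "x \<in> unit_cube \<Longrightarrow> x \<in> cell b N z \<longleftrightarrow> (\<forall>j. \<forall>i<N. real_digits b (x $ j) i = (z $ j) i)"
  by (auto simp: cell_def cell1_def mem_unit_cube)

lemma cell_borel:
  fixes z :: "(nat \<Rightarrow> nat) ^ 's::finite"
  assumes b: "b \<ge> 2" and z: "\<And>i j. (z $ j) i < b"
  shows "cell b N z \<in> sets borel"
proof -
  have "cell b N z = (\<Inter>j\<in>UNIV. (\<lambda>x. x $ j) -` cell1 b N (z $ j) \<inter> space borel)"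
    by (auto simp: cell_def)
  also have "\<dots> \<in> sets borel"
    by (intro sets.finite_INT measurable_sets[OF _ cell1_borel[OF b z]]
        borel_measurable_continuous_onI continuous_intros) auto
  finally show ?thesis .
qed

text \<open>The cell lies between an open box and its closure, which have the same measure.\<close>

lemma measure_cell:
  fixes z :: "(nat \<Rightarrow> nat) ^ 's::finite"
  assumes b: "b \<ge> 2" and z: "\<And>i j. (z $ j) i < b"
  shows "emeasure lborel (cell b N z) = ennreal (1 / real b ^ (N * CARD('s)))"
proof -
  define l :: "real ^ 's" where "l = (\<chi> j. real (digit_prefix b (z $ j) N) / real b ^ N)"
  define u :: "real ^ 's" where "u = (\<chi> j. (real (digit_prefix b (z $ j) N) + 1) / real b ^ N)"
  have "box l u \<subseteq> cell b N z"
    using cell1_superset[OF b] z by (auto simp: cell_def mem_box_cart l_def u_def)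
  then have 1: "emeasure lborel (box l u) \<le> emeasure lborel (cell b N z)"
    using cell_borel[OF b z] by (intro emeasure_mono) auto
  have "cell b N z \<subseteq> cbox l u"
    using cell1_subset[OF b] by (auto simp: cell_def mem_box_cart l_def u_def)
  then have 2: "emeasure lborel (cell b N z) \<le> emeasure lborel (cbox l u)"
    by (intro emeasure_mono) auto
  have lu: "\<And>j. l $ j \<le> u $ j"
    by (simp add: l_def u_def divide_right_mono)
  then have "\<And>e. e \<in> Basis \<Longrightarrow> l \<bullet> e \<le> u \<bullet> e"
    by (auto simp: Basis_vec_def inner_axis)
  then have "emeasure lborel (box l u) = emeasure lborel (cbox l u)"
    by simp
  then have "emeasure lborel (cell b N z) = emeasure lborel (cbox l u)"
    using 1 2 by (simp add: antisym)
  also have "\<dots> = ennreal (measure lborel (cbox l u))"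
    using emeasure_lborel_cbox_finite[of l u] by (intro emeasure_eq_ennreal_measure) auto
  also have "measure lborel (cbox l u) = (\<Prod>j\<in>UNIV. u $ j - l $ j)"
  proof (rule content_cbox_cart)
    have "l \<in> cbox l u" using lu by (simp add: mem_box_cart)
    then show "cbox l u \<noteq> {}" by blast
  qed
  also have "\<dots> = (\<Prod>j\<in>(UNIV :: 's set). 1 / real b ^ N)"
    by (simp add: l_def u_def diff_divide_distrib[symmetric])
  also have "\<dots> = 1 / real b ^ (N * CARD('s))"
    by (simp add: power_mult power_one_over)
  finally show ?thesis .
qed

lemma proj_G_bounds:
  assumes b: "b \<ge> 2" and z: "\<And>i j. (z $ j) i < b"
  shows "real (digit_prefix b (z $ j) N) / real b ^ N \<le> proj_G b z $ j"
    and "proj_G b z $ j \<le> (real (digit_prefix b (z $ j) N) + 1) / real b ^ N"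
  using prefix_bounds[OF b _ expansion_sums[OF b], of "z $ j" N] z by (auto simp: proj_G_def)

lemma proj_G_in_cube:
  assumes "b \<ge> 2" and "\<And>i j. (z $ j) i < b"
  shows "proj_G b z \<in> unit_cube"
  using proj_G_bounds[of b z _ 0] assms by (simp add: mem_unit_cube)

lemma dist_cell_proj_G:
  fixes z :: "(nat \<Rightarrow> nat) ^ 's::finite"
  assumes b: "b \<ge> 2" and z: "\<And>i j. (z $ j) i < b" and x: "x \<in> cell b N z"
  shows "dist x (proj_G b z) \<le> real CARD('s) * (1 / real b ^ N)"
proof -
  have "dist x (proj_G b z) \<le> (\<Sum>j\<in>UNIV. \<bar>(x - proj_G b z) $ j\<bar>)"
    unfolding dist_norm by (rule norm_le_l1_cart)
  also have "\<dots> \<le> (\<Sum>j\<in>(UNIV :: 's set). 1 / real b ^ N)"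
  proof (rule sum_mono)
    fix j
    have "x $ j \<in> cell1 b N (z $ j)" using x by (simp add: cell_def)
    from cell1_subset[OF b this] show "\<bar>(x - proj_G b z) $ j\<bar> \<le> 1 / real b ^ N"
      using proj_G_bounds[where z = z and j = j and N = N, OF b z]
      by (auto simp: add_divide_distrib abs_le_iff)
  qed
  finally show ?thesis by simp
qed

lemma cells_shrink:
  assumes "b \<ge> 2" and "d > 0"
  shows "\<forall>\<^sub>F N in sequentially. \<forall>z :: (nat \<Rightarrow> nat) ^ 's::finite. \<forall>x. (\<forall>i j. (z $ j) i < b) \<longrightarrow>
    x \<in> cell b N z \<longrightarrow> dist x (proj_G b z) < d"
proof -
  have "(\<lambda>N. real CARD('s) * (1 / real b ^ N)) \<longlonglongrightarrow> real CARD('s) * 0"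
    by (intro tendsto_intros inverse_power_tendsto_0 assms)
  then have "\<forall>\<^sub>F N in sequentially. real CARD('s) * (1 / real b ^ N) < d"
    using assms by (intro order_tendstoD) auto
  then show ?thesis
    by eventually_elim (use dist_cell_proj_G[OF assms(1)] le_less_trans in blast)
qed

lemma grid_point_less: "b \<ge> 2 \<Longrightarrow> (grid_point b N a $ j) i < b"
  by (simp add: grid_point_def nat_digit_less)

text \<open>Exactly one grid point has given first \<open>N\<close> digits. Counting these grid points by a sum of
  products over the digits gives existence and uniqueness at once.\<close>

lemma sum_grid_agree:
  fixes z :: "(nat \<Rightarrow> nat) ^ 's::finite"
  assumes b: "b \<ge> 2" and z: "\<And>i j. (z $ j) i < b"
  shows "(\<Sum>a\<in>index_box b N. if \<forall>j. \<forall>i<N. (z $ j) i = (grid_point b N a $ j) i then 1 else 0) = (1::real)"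
proof -
  have "(\<Sum>a\<in>index_box b N. if \<forall>j. \<forall>i<N. (z $ j) i = (grid_point b N a $ j) i then 1 else 0)
      = (\<Sum>a\<in>{a. \<forall>j::'s. a $ j \<in> {..<b ^ N}}. \<Prod>j\<in>UNIV. \<Prod>i<N. if (z $ j) i = nat_digit b (a $ j) i then 1 else (0::real))"
    unfolding prod_prod_if_const power_one by (simp add: index_box_def grid_point_def)
  also have "\<dots> = (\<Prod>j\<in>UNIV. \<Sum>a<b ^ N. \<Prod>i<N. if (z $ j) i = nat_digit b a i then 1 else 0)"
    by (rule sum_prod_vec) simp
  also have "\<dots> = (\<Prod>j\<in>UNIV. \<Prod>i<N. \<Sum>d<b. if (z $ j) i = d then 1 else 0)"
    by (intro prod.cong refl sum_prod_digits[OF b, where f = "\<lambda>i d. if (z $ _) i = d then 1 else 0"])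
  also have "\<dots> = 1" using z by simp
  finally show ?thesis .
qed

lemma sum_indicator_cells:
  fixes x :: "real ^ 's::finite"
  assumes b: "b \<ge> 2"
  shows "(\<Sum>a\<in>index_box b N. indicator (cell b N (grid_point b N a)) x) = (indicator unit_cube x :: real)"
proof (cases "x \<in> unit_cube")
  case True
  define z where "z = (\<chi> j. real_digits b (x $ j))"
  have "(z $ j) i < b" for i j
    using real_digits_expansion[OF b] True by (simp add: z_def mem_unit_cube)
  from sum_grid_agree[OF b this, of N] show ?thesis
    using True by (simp add: indicator_def mem_cell_iff z_def of_bool_def)
next
  case False
  then have "x \<notin> cell b N z" for z using cell_subset_cube by blast
  then show ?thesis using False by simp
qed

lemma char_G_cong:
  assumes b: "b \<ge> 2" and k: "k \<in> index_box b N"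
    and "\<And>j i. i < N \<Longrightarrow> (z $ j) i = (w $ j) i"
  shows "char_G b k z = char_G b k w"
  unfolding char_G_def using assms
  by (intro prod.cong refl) (simp add: char1_eq_prod_less[OF b, of _ N] index_box_def)

lemma index_box_mono: "b \<ge> 2 \<Longrightarrow> N \<le> M \<Longrightarrow> index_box b N \<subseteq> index_box b M"
  using order_less_le_trans[OF _ power_increasing[of N M b]] by (auto simp: index_box_def)

lemma index_box_exhausts:
  fixes k :: "nat ^ 's::finite"
  assumes "b \<ge> 2"
  shows "\<forall>\<^sub>F N in sequentially. k \<in> index_box b N"
proof -
  define n where "n = Max (range (vec_nth k))"
  have "k $ j < b ^ n" for j
  proof -
    have "k $ j \<le> n" unfolding n_def by (rule Max_ge) auto
    then show ?thesis using nat_less_base_power[OF assms, of n] by linarith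
  qed
  then have "k \<in> index_box b n" by (simp add: index_box_def)
  then show ?thesis
    unfolding eventually_sequentially using index_box_mono[OF assms] by blast
qed

text \<open>A Walsh function whose index has at most \<open>N\<close> digits is constant on the cells of order \<open>N\<close>.\<close>

lemma wal_measurable:
  fixes k :: "nat ^ 's::finite"
  assumes b: "b \<ge> 2"
  shows "(\<lambda>x. indicator unit_cube x *\<^sub>R wal b k x) \<in> borel_measurable borel"
proof -
  obtain N where N: "k \<in> index_box b N"
    using index_box_exhausts[OF b] eventually_happens'[OF sequentially_bot] by blast
  have "indicator unit_cube x *\<^sub>R wal b k x
      = (\<Sum>a\<in>index_box b N. indicator (cell b N (grid_point b N a)) x *\<^sub>R char_G b k (grid_point b N a))" for x
  proof -
    have "indicator unit_cube x *\<^sub>R wal b k x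
      = (\<Sum>a\<in>index_box b N. indicator (cell b N (grid_point b N a)) x *\<^sub>R wal b k x)"
      by (simp flip: sum_indicator_cells[OF b, of N] scaleR_left.sum)
    also have "\<dots> = (\<Sum>a\<in>index_box b N. indicator (cell b N (grid_point b N a)) x *\<^sub>R char_G b k (grid_point b N a))"
    proof (rule sum.cong[OF refl])
      fix a
      show "indicator (cell b N (grid_point b N a)) x *\<^sub>R wal b k x
        = indicator (cell b N (grid_point b N a)) x *\<^sub>R char_G b k (grid_point b N a)"
      proof (cases "x \<in> cell b N (grid_point b N a)")
        case True
        then have "wal b k x = char_G b k (grid_point b N a)"
          unfolding wal_eq_char_G by (intro char_G_cong[OF b N]) (simp add: cell_def cell1_def)
        then show ?thesis by simp
      qed simp
    qed
    finally show ?thesis .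
  qed
  moreover have "(\<lambda>x. \<Sum>a\<in>index_box b N. indicator (cell b N (grid_point b N a)) x *\<^sub>R char_G b k (grid_point b N a)) \<in> borel_measurable borel"
    by (intro borel_measurable_sum borel_measurable_scaleR borel_measurable_indicator
        cell_borel[OF b] grid_point_less[OF b] borel_measurable_const)
  ultimately show ?thesis by simp
qed

section \<open>The Walsh expansion of a continuous kernel on the group\<close>

text \<open>Used for cells in the cube, which gives convergence of Riemann sums, and for products of two
  cells, which gives convergence of the Walsh series of a kernel.\<close>

lemma set_integral_average_close:
  fixes f :: "'a \<Rightarrow> 'b :: {banach, second_countable_topology}"
  assumes f: "set_integrable M A f" and A: "A \<in> sets M" "emeasure M A < \<infinity>"
    and close: "\<And>x. x \<in> A \<Longrightarrow> norm (f x - c) \<le> e"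
  shows "norm (set_lebesgue_integral M A f - measure M A *\<^sub>R c) \<le> measure M A * e"
proof -
  have c: "set_integrable M A (\<lambda>x. c)"
    unfolding set_integrable_def using A by simp
  have e: "set_integrable M A (\<lambda>x. e)"
    unfolding set_integrable_def using A by simp
  have "set_lebesgue_integral M A (\<lambda>x. c) = measure M A *\<^sub>R c"
    unfolding set_lebesgue_integral_def using A by simp
  then have "set_lebesgue_integral M A f - measure M A *\<^sub>R c = set_lebesgue_integral M A (\<lambda>x. f x - c)"
    using set_integral_diff(2)[OF f c] by simp
  also have "norm \<dots> \<le> (\<integral>x. norm (indicator A x *\<^sub>R (f x - c)) \<partial>M)"
    unfolding set_lebesgue_integral_def by (rule integral_norm_bound)
  also have "\<dots> \<le> set_lebesgue_integral M A (\<lambda>x. e)"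
    unfolding set_lebesgue_integral_def
  proof (rule Bochner_Integration.integral_mono)
    show "integrable M (\<lambda>x. norm (indicator A x *\<^sub>R (f x - c)))"
      by (rule integrable_norm[OF set_integral_diff(1)[OF f c, unfolded set_integrable_def]])
    show "integrable M (\<lambda>x. indicator A x *\<^sub>R e)"
      using e by (simp add: set_integrable_def)
    show "norm (indicator A x *\<^sub>R (f x - c)) \<le> indicator A x *\<^sub>R e" for x
      using close by (simp add: indicator_def)
  qed
  also have "\<dots> = measure M A * e"
    unfolding set_lebesgue_integral_def using A by simp
  finally show ?thesis .
qed

text \<open>Cells are the digit analogue of subdividing the cube, so averages over the grid of
  points with at most N digits are Riemann sums.\<close>

lemma grid_average_tendsto_integral:
  fixes f :: "real ^ 's::finite \<Rightarrow> real"
  assumes b: "b \<ge> 2" and f: "continuous_on unit_cube f"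
  shows "(\<lambda>N. \<Sum>a\<in>index_box b N. 1 / real b ^ (N * CARD('s)) * f (proj_G b (grid_point b N a)))
    \<longlonglongrightarrow> set_lebesgue_integral lborel unit_cube f"
proof -
  let ?I = "set_lebesgue_integral lborel unit_cube f"
  let ?v = "\<lambda>N. 1 / real b ^ (N * CARD('s))"
  let ?g = "grid_point b :: nat \<Rightarrow> nat ^ 's \<Rightarrow> (nat \<Rightarrow> nat) ^ 's"
  have int: "set_integrable lborel unit_cube f"
    unfolding set_integrable_def by (rule borel_integrable_compact[OF compact_cbox f])
  have intc: "set_integrable lborel (cell b N (?g N a)) f" for N a
    by (rule set_integrable_subset[OF int]) (auto intro!: cell_borel b grid_point_less cell_subset_cube)
  have split: "?I = (\<Sum>a\<in>index_box b N. set_lebesgue_integral lborel (cell b N (?g N a)) f)" for N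
  proof -
    have "(\<Sum>a\<in>index_box b N. set_lebesgue_integral lborel (cell b N (?g N a)) f)
        = (\<integral>x. (\<Sum>a\<in>index_box b N. indicator (cell b N (?g N a)) x *\<^sub>R f x) \<partial>lborel)"
      unfolding set_lebesgue_integral_def
      using intc by (subst Bochner_Integration.integral_sum) (auto simp: set_integrable_def)
    also have "\<dots> = ?I"
      unfolding set_lebesgue_integral_def
      by (simp only: sum_indicator_cells[OF b] scaleR_left.sum[symmetric])
    finally show ?thesis ..
  qed
  show ?thesis
    unfolding LIMSEQ_iff real_norm_def
  proof (intro allI impI)
    fix e :: real assume "e > 0"
    have "uniformly_continuous_on unit_cube f"
      by (rule compact_uniformly_continuous[OF f compact_cbox])
    then obtain d where d: "d > 0"
      "\<And>x y. x \<in> unit_cube \<Longrightarrow> y \<in> unit_cube \<Longrightarrow> dist y x < d \<Longrightarrow> dist (f y) (f x) < e / 2"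
      using \<open>e > 0\<close> unfolding uniformly_continuous_on_def by (metis half_gt_zero)
    obtain N0 where N0: "\<And>N (z :: (nat \<Rightarrow> nat) ^ 's) x. N \<ge> N0 \<Longrightarrow> (\<forall>i j. (z $ j) i < b) \<Longrightarrow>
        x \<in> cell b N z \<Longrightarrow> dist x (proj_G b z) < d"
      using cells_shrink[OF b d(1), where 's = 's] unfolding eventually_sequentially by blast
    have "\<bar>(\<Sum>a\<in>index_box b N. ?v N * f (proj_G b (?g N a))) - ?I\<bar> < e" if "N \<ge> N0" for N
    proof -
      have m: "measure lborel (cell b N (?g N a)) = ?v N"
        and fin: "emeasure lborel (cell b N (?g N a)) < \<infinity>" for a
        using measure_cell[OF b, of "?g N a" N, OF grid_point_less[OF b]] by (simp_all add: measure_def)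
      have one: "\<bar>set_lebesgue_integral lborel (cell b N (?g N a)) f - ?v N * f (proj_G b (?g N a))\<bar>
          \<le> ?v N * (e / 2)" for a
      proof -
        have "norm (f x - f (proj_G b (?g N a))) \<le> e / 2" if x: "x \<in> cell b N (?g N a)" for x
        proof -
          have "dist x (proj_G b (?g N a)) < d"
            using N0[OF \<open>N \<ge> N0\<close> _ x] grid_point_less[OF b] by blast
          moreover have "x \<in> unit_cube" using x cell_subset_cube by blast
          moreover have "proj_G b (?g N a) \<in> unit_cube"
            by (intro proj_G_in_cube b grid_point_less)
          ultimately show ?thesis using d(2) by (fastforce simp: dist_norm)
        qed
        from set_integral_average_close[OF intc _ fin this] show ?thesis
          using cell_borel[OF b, of "?g N a" N, OF grid_point_less[OF b]] by (simp add: m)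
      qed
      have "\<bar>?I - (\<Sum>a\<in>index_box b N. ?v N * f (proj_G b (?g N a)))\<bar>
          \<le> (\<Sum>a\<in>(index_box b N :: (nat ^ 's) set). ?v N * (e / 2))"
        unfolding split[of N] sum_subtractf[symmetric]
        by (rule order_trans[OF sum_abs]) (intro sum_mono one)
      also have "\<dots> = e / 2"
        using b by (simp add: card_index_box)
      finally show ?thesis using \<open>e > 0\<close> by linarith
    qed
    then show "\<exists>N0. \<forall>N\<ge>N0. \<bar>(\<Sum>a\<in>index_box b N. ?v N * f (proj_G b (?g N a))) - ?I\<bar> < e"
      by blast
  qed
qed

lemma walsh_integrable:
  fixes K :: "real ^ 's::finite \<Rightarrow> real ^ 's \<Rightarrow> real"
  assumes b: "b \<ge> 2" and cont: "continuous_on (unit_cube \<times> unit_cube) (\<lambda>(x, y). K x y)"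
  shows "set_integrable lborel (unit_cube \<times> unit_cube)
    (\<lambda>(x, y). of_real (K x y) * cnj (wal b k x) * wal b l y)"
proof -
  let ?Q = "unit_cube \<times> unit_cube :: ((real ^ 's) \<times> (real ^ 's)) set"
  have cQ: "compact ?Q" by (intro compact_Times compact_cbox)
  have "bounded ((\<lambda>(x, y). K x y) ` ?Q)"
    by (intro compact_imp_bounded compact_continuous_image cont cQ)
  then obtain B where B: "\<And>x y. (x, y) \<in> ?Q \<Longrightarrow> \<bar>K x y\<bar> \<le> B"
    unfolding bounded_iff by force
  let ?f = "\<lambda>p. complex_of_real (indicator ?Q p *\<^sub>R (\<lambda>(x, y). K x y) p) *
    cnj (indicator unit_cube (fst p) *\<^sub>R wal b k (fst p)) * (indicator unit_cube (snd p) *\<^sub>R wal b l (snd p))"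
  have m1: "(\<lambda>p. indicator ?Q p *\<^sub>R (\<lambda>(x, y). K x y) p) \<in> borel_measurable borel"
    by (intro borel_measurable_continuous_on_indicator cont borel_closed closed_Times closed_cbox)
  have m2: "(\<lambda>p :: (real ^ 's) \<times> (real ^ 's). indicator unit_cube (fst p) *\<^sub>R wal b k (fst p)) \<in> borel_measurable borel"
    by (rule measurable_compose[OF _ wal_measurable[OF b]])
      (intro borel_measurable_continuous_onI continuous_intros)
  have m3: "(\<lambda>p :: (real ^ 's) \<times> (real ^ 's). indicator unit_cube (snd p) *\<^sub>R wal b l (snd p)) \<in> borel_measurable borel"
    by (rule measurable_compose[OF _ wal_measurable[OF b]])
      (intro borel_measurable_continuous_onI continuous_intros)
  have m4: "(\<lambda>p :: (real ^ 's) \<times> (real ^ 's). cnj (indicator unit_cube (fst p) *\<^sub>R wal b k (fst p))) \<in> borel_measurable borel"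
    by (rule measurable_compose[OF m2]) (intro borel_measurable_continuous_onI continuous_intros)
  have m5: "(\<lambda>p. complex_of_real (indicator ?Q p *\<^sub>R (\<lambda>(x, y). K x y) p)) \<in> borel_measurable borel"
    by (rule measurable_compose[OF m1]) (intro borel_measurable_continuous_onI continuous_intros)
  have "?f \<in> borel_measurable borel" by (intro borel_measurable_times m5 m4 m3)
  then have "integrable lborel (\<lambda>p. indicator ?Q p *\<^sub>R ?f p)"
  proof (intro integrableI_bounded_set_indicator[where B = B])
    show "?Q \<in> sets lborel" using borel_closed[OF closed_Times[OF closed_cbox closed_cbox]] by simp
    show "emeasure lborel ?Q < \<infinity>" by (rule emeasure_compact_finite[OF cQ])
    show "AE p in lborel. p \<in> ?Q \<longrightarrow> norm (?f p) \<le> B"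
      using B by (intro always_eventually) (auto simp: norm_mult wal_eq_char_G)
  qed simp
  also have "(\<lambda>p. indicator ?Q p *\<^sub>R ?f p)
      = (\<lambda>p. indicator ?Q p *\<^sub>R (\<lambda>(x, y). of_real (K x y) * cnj (wal b k x) * wal b l y) p)"
    by (auto simp: fun_eq_iff indicator_def)
  finally show ?thesis unfolding set_integrable_def .
qed

text \<open>Summing the Walsh series over all indices with at most N digits collapses, by the
  Dirichlet kernel, to the average of the kernel over a product of two cells. This is why the
  expansion converges at every point of the group, also at those which project to b-adic
  rationals but are not the digit sequences chosen by the Walsh functions: the cells of such a
  point still shrink to its projection.\<close>

lemma walsh_partial_sum:
  fixes K :: "real ^ 's::finite \<Rightarrow> real ^ 's \<Rightarrow> real"
  assumes b: "b \<ge> 2" and cont: "continuous_on (unit_cube \<times> unit_cube) (\<lambda>(x, y). K x y)"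
    and z: "\<And>i j. (z $ j) i < b" and w: "\<And>i j. (w $ j) i < b"
  shows "(\<Sum>(k, l)\<in>index_box b N \<times> index_box b N. walsh_coeff b K k l * (char_G b k z * cnj (char_G b l w)))
    = of_real (real b ^ (2 * N * CARD('s)) *
        set_lebesgue_integral lborel (cell b N z \<times> cell b N w) (\<lambda>(x, y). K x y))"
proof -
  let ?Q = "unit_cube \<times> unit_cube :: ((real ^ 's) \<times> (real ^ 's)) set"
  let ?V = "of_nat (b ^ (N * CARD('s))) :: complex"
  let ?F = "\<lambda>k l p. indicator ?Q p *\<^sub>R (\<lambda>(x, y). of_real (K x y) * cnj (wal b k x) * wal b l y) p"
  have kern: "(\<Sum>k\<in>index_box b N. char_G b k u * cnj (wal b k x)) = ?V * indicator (cell b N u) x"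
    if "\<And>i j. (u $ j) i < b" and x: "x \<in> unit_cube" for u :: "(nat \<Rightarrow> nat) ^ 's" and x
  proof -
    have "((\<chi> j. real_digits b (x $ j)) $ j) i < b" for i j
      using real_digits_expansion[OF b] x by (simp add: mem_unit_cube)
    from dirichlet_kernel[OF b that(1) this] show ?thesis
      by (auto simp: wal_eq_char_G mem_cell_iff[OF x] indicator_def)
  qed
  have kern': "(\<Sum>k\<in>index_box b N. cnj (char_G b k u) * wal b k x) = ?V * indicator (cell b N u) x"
    if "\<And>i j. (u $ j) i < b" and x: "x \<in> unit_cube" for u :: "(nat \<Rightarrow> nat) ^ 's" and x
    using arg_cong[OF kern[OF that], of cnj] by (simp add: indicator_def)
  have int: "integrable lborel (?F k l)" for k l
    using walsh_integrable[OF b cont] unfolding set_integrable_def .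
  have "(\<Sum>(k, l)\<in>index_box b N \<times> index_box b N. walsh_coeff b K k l * (char_G b k z * cnj (char_G b l w)))
      = (\<Sum>p\<in>index_box b N \<times> index_box b N. \<integral>q. char_G b (fst p) z * cnj (char_G b (snd p) w) * ?F (fst p) (snd p) q \<partial>lborel)"
    unfolding split_def walsh_coeff_def set_lebesgue_integral_def
    by (intro sum.cong refl, subst integral_mult_right_zero) (rule mult.commute)
  also have "\<dots> = (\<integral>q. (\<Sum>p\<in>index_box b N \<times> index_box b N. char_G b (fst p) z * cnj (char_G b (snd p) w) * ?F (fst p) (snd p) q) \<partial>lborel)"
    by (rule Bochner_Integration.integral_sum[symmetric]) (intro integrable_mult_right int)
  also have "\<dots> = (\<integral>q. of_real (real b ^ (2 * N * CARD('s)) *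
      (indicator (cell b N z \<times> cell b N w) q *\<^sub>R (\<lambda>(x, y). K x y) q)) \<partial>lborel)"
  proof (rule Bochner_Integration.integral_cong[OF refl])
    fix q :: "(real ^ 's) \<times> (real ^ 's)"
    obtain x y where q: "q = (x, y)" by (cases q)
    show "(\<Sum>p\<in>index_box b N \<times> index_box b N. char_G b (fst p) z * cnj (char_G b (snd p) w) * ?F (fst p) (snd p) q)
      = of_real (real b ^ (2 * N * CARD('s)) * (indicator (cell b N z \<times> cell b N w) q *\<^sub>R (\<lambda>(x, y). K x y) q))"
    proof (cases "q \<in> ?Q")
      case True
      then have xy: "x \<in> unit_cube" "y \<in> unit_cube" by (auto simp: q)
      have "(\<Sum>p\<in>index_box b N \<times> index_box b N. char_G b (fst p) z * cnj (char_G b (snd p) w) * ?F (fst p) (snd p) q)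
          = (\<Sum>k\<in>index_box b N. \<Sum>l\<in>index_box b N. of_real (K x y) *
              ((char_G b k z * cnj (wal b k x)) * (cnj (char_G b l w) * wal b l y)))"
        using xy by (simp add: q sum.cartesian_product split_def mult_ac)
      also have "\<dots> = of_real (K x y) * ((\<Sum>k\<in>index_box b N. char_G b k z * cnj (wal b k x)) *
          (\<Sum>l\<in>index_box b N. cnj (char_G b l w) * wal b l y))"
        by (subst sum_product) (simp only: sum_distrib_left)
      also have "\<dots> = of_real (K x y) * ((?V * indicator (cell b N z) x) * (?V * indicator (cell b N w) y))"
        by (simp only: kern[OF z xy(1)] kern'[OF w xy(2)])
      also have "\<dots> = of_real (real b ^ (2 * N * CARD('s)) * (indicator (cell b N z \<times> cell b N w) q *\<^sub>R (\<lambda>(x, y). K x y) q))"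
        by (auto simp: q indicator_def power_add[symmetric] mult_2 distrib_right)
      finally show ?thesis .
    next
      case False
      then have "q \<notin> cell b N z \<times> cell b N w" using cell_subset_cube by blast
      then show ?thesis using False by simp
    qed
  qed
  also have "\<dots> = of_real (real b ^ (2 * N * CARD('s)) *
      set_lebesgue_integral lborel (cell b N z \<times> cell b N w) (\<lambda>(x, y). K x y))"
    unfolding set_lebesgue_integral_def integral_complex_of_real integral_mult_right_zero ..
  finally show ?thesis .
qed

lemma walsh_partial_sum_tendsto:
  fixes K :: "real ^ 's::finite \<Rightarrow> real ^ 's \<Rightarrow> real"
  assumes b: "b \<ge> 2" and cont: "continuous_on (unit_cube \<times> unit_cube) (\<lambda>(x, y). K x y)"
    and z: "\<And>i j. (z $ j) i < b" and w: "\<And>i j. (w $ j) i < b"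
  shows "(\<lambda>N. real b ^ (2 * N * CARD('s)) *
      set_lebesgue_integral lborel (cell b N z \<times> cell b N w) (\<lambda>(x, y). K x y))
    \<longlonglongrightarrow> K (proj_G b z) (proj_G b w)"
  unfolding LIMSEQ_iff real_norm_def
proof (intro allI impI)
  fix e :: real assume "e > 0"
  let ?Q = "unit_cube \<times> unit_cube :: ((real ^ 's) \<times> (real ^ 's)) set"
  let ?p = "(proj_G b z, proj_G b w)"
  let ?c = "K (proj_G b z) (proj_G b w)"
  have p: "?p \<in> ?Q" using proj_G_in_cube[OF b z] proj_G_in_cube[OF b w] by simp
  obtain d where d: "d > 0" "\<And>q. q \<in> ?Q \<Longrightarrow> dist q ?p < d \<Longrightarrow> dist ((\<lambda>(x, y). K x y) q) ?c < e / 2"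
  proof -
    have "e / 2 > 0" using \<open>e > 0\<close> by simp
    with cont p show ?thesis
      unfolding continuous_on_iff using that by (metis (no_types, lifting) case_prod_conv)
  qed
  obtain N0 where N0: "\<And>N (z :: (nat \<Rightarrow> nat) ^ 's) x. N \<ge> N0 \<Longrightarrow> (\<forall>i j. (z $ j) i < b) \<Longrightarrow>
      x \<in> cell b N z \<Longrightarrow> dist x (proj_G b z) < d / 2"
    using cells_shrink[OF b, of "d / 2", where 's = 's] d(1) unfolding eventually_sequentially by force
  have "\<bar>real b ^ (2 * N * CARD('s)) *
      set_lebesgue_integral lborel (cell b N z \<times> cell b N w) (\<lambda>(x, y). K x y) - ?c\<bar> < e"
    if N: "N \<ge> N0" for N
  proof -
    let ?A = "cell b N z \<times> cell b N w" and ?v = "1 / real b ^ (2 * N * CARD('s))"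
    have close: "norm ((\<lambda>(x, y). K x y) q - ?c) \<le> e / 2" if q: "q \<in> ?A" for q
    proof -
      have "dist (fst q) (proj_G b z) < d / 2" "dist (snd q) (proj_G b w) < d / 2"
        using N0[OF N, of z "fst q"] N0[OF N, of w "snd q"] z w q by auto
      then have "dist q ?p < d"
        unfolding dist_prod_def
        using sqrt_sum_squares_le_sum[of "dist (fst q) (proj_G b z)" "dist (snd q) (proj_G b w)"] by simp
      moreover have "q \<in> ?Q" using q cell_subset_cube by blast
      ultimately show ?thesis using d(2)[of q] by (simp add: dist_norm)
    qed
    have "emeasure lborel ?A = emeasure (lborel \<Otimes>\<^sub>M lborel) ?A" by (simp add: lborel_prod)
    also have "\<dots> = ennreal (1 / real b ^ (N * CARD('s))) * ennreal (1 / real b ^ (N * CARD('s)))"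
      using cell_borel[OF b z, of N] cell_borel[OF b w, of N]
      by (subst lborel.emeasure_pair_measure_Times) (auto simp: measure_cell[OF b z] measure_cell[OF b w])
    also have "\<dots> = ennreal ?v"
      by (simp add: ennreal_mult[symmetric] power_add[symmetric] mult_2 distrib_right)
    finally have em: "emeasure lborel ?A = ennreal ?v" .
    then have me: "measure lborel ?A = ?v" by (simp add: measure_def)
    have "?A \<in> sets (lborel \<Otimes>\<^sub>M lborel)"
      by (rule pair_measureI) (simp_all add: cell_borel[OF b z] cell_borel[OF b w])
    then have A: "?A \<in> sets lborel" unfolding lborel_prod .
    have "set_integrable lborel ?Q (\<lambda>(x, y). K x y)"
      unfolding set_integrable_def by (rule borel_integrable_compact[OF compact_Times[OF compact_cbox compact_cbox] cont])
    then have "set_integrable lborel ?A (\<lambda>(x, y). K x y)"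
      by (rule set_integrable_subset[OF _ A]) (use cell_subset_cube in blast)
    from set_integral_average_close[OF this A _ close]
    have "\<bar>set_lebesgue_integral lborel ?A (\<lambda>(x, y). K x y) - ?v * ?c\<bar> \<le> ?v * (e / 2)"
      by (simp add: em me)
    then have "1 / ?v * \<bar>set_lebesgue_integral lborel ?A (\<lambda>(x, y). K x y) - ?v * ?c\<bar> \<le> 1 / ?v * (?v * (e / 2))"
      by (rule mult_left_mono) simp
    also have "1 / ?v * (?v * (e / 2)) = e / 2" using b by simp
    also have "1 / ?v * \<bar>set_lebesgue_integral lborel ?A (\<lambda>(x, y). K x y) - ?v * ?c\<bar>
        = \<bar>1 / ?v * (set_lebesgue_integral lborel ?A (\<lambda>(x, y). K x y) - ?v * ?c)\<bar>"
      by (simp add: abs_mult)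
    also have "1 / ?v * (set_lebesgue_integral lborel ?A (\<lambda>(x, y). K x y) - ?v * ?c)
        = real b ^ (2 * N * CARD('s)) * set_lebesgue_integral lborel ?A (\<lambda>(x, y). K x y) - ?c"
      using b by (simp add: right_diff_distrib)
    finally show ?thesis using \<open>e > 0\<close> by simp
  qed
  then show "\<exists>N0. \<forall>N\<ge>N0. \<bar>real b ^ (2 * N * CARD('s)) *
      set_lebesgue_integral lborel (cell b N z \<times> cell b N w) (\<lambda>(x, y). K x y) - ?c\<bar> < e"
    by blast
qed

text \<open>Absolute convergence lets the sum be evaluated along the boxes of indices with at most \<open>N\<close>
  digits, where the limit is known from averages over shrinking cells.\<close>

lemma walsh_expansion:
  fixes K :: "real ^ 's::finite \<Rightarrow> real ^ 's \<Rightarrow> real"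
  assumes b: "b \<ge> 2" and cont: "continuous_on (unit_cube \<times> unit_cube) (\<lambda>(x, y). K x y)"
    and summ: "(\<lambda>(k, l). norm (walsh_coeff b K k l)) summable_on UNIV"
    and z: "\<And>i j. (z $ j) i < b" and w: "\<And>i j. (w $ j) i < b"
  shows "((\<lambda>(k, l). walsh_coeff b K k l * (char_G b k z * cnj (char_G b l w)))
    has_sum of_real (K (proj_G b z) (proj_G b w))) UNIV"
proof -
  let ?f = "\<lambda>(k, l). walsh_coeff b K k l * (char_G b k z * cnj (char_G b l w))"
  let ?B = "\<lambda>N. index_box b N \<times> index_box b N :: ((nat ^ 's) \<times> (nat ^ 's)) set"
  have "(\<lambda>p. norm (?f p)) summable_on UNIV"
    using summ by (rule summable_on_cong[THEN iffD1, rotated]) (auto simp: norm_mult)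
  then have "?f summable_on UNIV" by (rule abs_summable_summable)
  then obtain S where S: "(?f has_sum S) UNIV" by (auto simp: summable_on_def)
  have "filterlim ?B (finite_subsets_at_top UNIV) sequentially"
    unfolding filterlim_finite_subsets_at_top
  proof (intro allI impI)
    fix X :: "((nat ^ 's) \<times> (nat ^ 's)) set" assume X: "finite X \<and> X \<subseteq> UNIV"
    have "\<forall>\<^sub>F N in sequentially. p \<in> ?B N" for p :: "(nat ^ 's) \<times> (nat ^ 's)"
      using eventually_conj[OF index_box_exhausts[OF b, of "fst p"] index_box_exhausts[OF b, of "snd p"]]
      by (simp add: mem_Times_iff)
    then have "\<forall>\<^sub>F N in sequentially. \<forall>p\<in>X. p \<in> ?B N"
      using X by (intro eventually_ball_finite) auto
    then show "\<forall>\<^sub>F N in sequentially. finite (?B N) \<and> X \<subseteq> ?B N \<and> ?B N \<subseteq> UNIV"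
      by eventually_elim auto
  qed
  then have "(\<lambda>N. sum ?f (?B N)) \<longlonglongrightarrow> S"
    using S unfolding has_sum_def by (rule filterlim_compose[rotated])
  moreover have "(\<lambda>N. sum ?f (?B N)) \<longlonglongrightarrow> of_real (K (proj_G b z) (proj_G b w))"
    unfolding walsh_partial_sum[OF b cont z w]
    by (intro tendsto_of_real walsh_partial_sum_tendsto[OF b cont z w])
  ultimately show ?thesis using S LIMSEQ_unique by blast
qed

section \<open>Worst-case errors in a reproducing kernel Hilbert space\<close>

context rkhs
begin

lemma diff_mem: "f \<in> H \<Longrightarrow> g \<in> H \<Longrightarrow> (\<lambda>x. f x - g x) \<in> H"
  using add_mem[OF _ scale_mem[of g "-1"], of f] by simp

lemma ip_diff: "f \<in> H \<Longrightarrow> g \<in> H \<Longrightarrow> h \<in> H \<Longrightarrow> ip (\<lambda>x. f x - g x) h = ip f h - ip g h"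
  using ip_add[OF _ scale_mem[of g "-1"], of f h] ip_scale[of g h "-1"] by simp

lemma ip_add_right: "f \<in> H \<Longrightarrow> g \<in> H \<Longrightarrow> h \<in> H \<Longrightarrow> ip h (\<lambda>x. f x + g x) = ip h f + ip h g"
  using ip_add[of f g h] ip_commute add_mem by metis

lemma ip_scale_right: "f \<in> H \<Longrightarrow> g \<in> H \<Longrightarrow> ip g (\<lambda>x. c * f x) = c * ip g f"
  using ip_scale[of f g c] ip_commute scale_mem by metis

lemma Cauchy_Schwarz:
  assumes f: "f \<in> H" and g: "g \<in> H"
  shows "\<bar>ip f g\<bar> \<le> sqrt (ip f f) * sqrt (ip g g)"
proof (cases "ip g g = 0")
  case True
  then have "g = (\<lambda>x. 0 * g x)" using ip_definite[OF g] by simp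
  then have "ip g f = 0" using ip_scale[OF g f, of 0] by simp
  then show ?thesis using ip_commute[OF f g] True by simp
next
  case False
  then have pos: "ip g g > 0" using ip_nonneg[OF g] by simp
  define t where "t = ip f g / ip g g"
  let ?h = "\<lambda>x. f x - t * g x"
  have tg: "(\<lambda>x. t * g x) \<in> H" using scale_mem[OF g] .
  have h: "?h \<in> H" using diff_mem[OF f tg] .
  have "ip ?h ?h = ip f ?h - t * ip g ?h"
    using ip_diff[OF f tg h] ip_scale[OF g h, of t] by simp
  also have "ip f ?h = ip f f - t * ip f g"
    using ip_commute[OF f h] ip_diff[OF f tg f] ip_scale[OF g f, of t] ip_commute[OF f g] by simp
  also have "ip g ?h = ip f g - t * ip g g"
    using ip_commute[OF g h] ip_diff[OF f tg g] ip_scale[OF g g, of t] by simp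
  finally have "ip ?h ?h = ip f f - t * ip f g"
    using pos by (simp add: t_def)
  then have "t * ip f g \<le> ip f f" using ip_nonneg[OF h] by simp
  then have "(ip f g)\<^sup>2 \<le> ip f f * ip g g"
    using pos by (simp add: t_def power2_eq_square pos_divide_le_eq)
  then have "sqrt ((ip f g)\<^sup>2) \<le> sqrt (ip f f * ip g g)" by (rule real_sqrt_le_mono)
  then show ?thesis by (simp add: real_sqrt_mult)
qed

definition kernel_at :: "'a \<Rightarrow> 'a \<Rightarrow> real" where
  "kernel_at y = (\<lambda>x. if x \<in> D then K x y else 0)"

lemma kernel_at_mem: "y \<in> D \<Longrightarrow> kernel_at y \<in> H"
  and ip_kernel_at: "f \<in> H \<Longrightarrow> y \<in> D \<Longrightarrow> ip f (kernel_at y) = f y"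
  using kernel_mem reproducing by (simp_all add: kernel_at_def)

lemma kernel_combination:
  assumes "finite I" and "\<And>i. i \<in> I \<Longrightarrow> x i \<in> D"
  shows "(\<lambda>u. \<Sum>i\<in>I. c i * kernel_at (x i) u) \<in> H \<and>
    (\<forall>f\<in>H. ip f (\<lambda>u. \<Sum>i\<in>I. c i * kernel_at (x i) u) = (\<Sum>i\<in>I. c i * f (x i)))"
  using assms
proof (induction I rule: finite_induct)
  case empty
  have "ip f (\<lambda>u. 0) = 0" if "f \<in> H" for f
    using ip_scale_right[OF zero_mem that, of 0] by simp
  then show ?case using zero_mem by simp
next
  case (insert i I)
  have k: "kernel_at (x i) \<in> H" using insert.prems by (intro kernel_at_mem) simp
  then have "(\<lambda>u. c i * kernel_at (x i) u) \<in> H" by (rule scale_mem)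
  moreover have "(\<lambda>u. \<Sum>i\<in>I. c i * kernel_at (x i) u) \<in> H" using insert by simp
  moreover have "ip f (\<lambda>u. c i * kernel_at (x i) u) = c i * f (x i)" if "f \<in> H" for f
    using ip_scale_right[OF k that] ip_kernel_at[OF that] insert.prems by simp
  ultimately show ?case
    using insert.IH insert.prems insert.hyps add_mem ip_add_right by simp
qed

text \<open>A functional that is a pointwise limit of finite combinations of point evaluations has its
  norm determined by the kernel values at the evaluation points: the combinations are inner
  products with elements R N of the space, and the mutual inner products of these converge. The
  Cauchy-Schwarz inequality with R N bounds the functional, and evaluating it on R N shows that
  the bound is attained in the limit. In this way the norm is found
  without constructing an element that represents the functional.\<close>

lemma SUP_functional_power2:
  fixes x :: "nat \<Rightarrow> 'i \<Rightarrow> 'a" and c :: "nat \<Rightarrow> 'i \<Rightarrow> real"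
  assumes I: "\<And>N. finite (I N)" and x: "\<And>N i. i \<in> I N \<Longrightarrow> x N i \<in> D"
    and L: "\<And>f. f \<in> H \<Longrightarrow> (\<lambda>N. \<Sum>i\<in>I N. c N i * f (x N i)) \<longlonglongrightarrow> L f"
    and gram: "\<And>e. e > 0 \<Longrightarrow> \<exists>N0. \<forall>N\<ge>N0. \<forall>M\<ge>N0.
      \<bar>(\<Sum>i\<in>I N. \<Sum>j\<in>I M. c N i * c M j * K (x N i) (x M j)) - S\<bar> < e"
  shows "(SUP f\<in>{f \<in> H. sqrt (ip f f) \<le> 1}. \<bar>L f\<bar>)\<^sup>2 = S"
proof -
  define R where "R N = (\<lambda>u. \<Sum>i\<in>I N. c N i * kernel_at (x N i) u)" for N
  have R: "R N \<in> H" and ipR: "f \<in> H \<Longrightarrow> ip f (R N) = (\<Sum>i\<in>I N. c N i * f (x N i))" for N f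
    using kernel_combination[of "I N" "x N" "c N"] I x unfolding R_def by blast+
  have T: "ip (R M) (R N) = (\<Sum>i\<in>I N. \<Sum>j\<in>I M. c N i * c M j * K (x N i) (x M j))" for N M
  proof -
    have "ip (R M) (R N) = (\<Sum>i\<in>I N. c N i * (\<Sum>j\<in>I M. c M j * kernel_at (x M j) (x N i)))"
      unfolding ipR[OF R] by (simp add: R_def)
    also have "\<dots> = (\<Sum>i\<in>I N. \<Sum>j\<in>I M. c N i * c M j * K (x N i) (x M j))"
      using x by (simp add: sum_distrib_left mult.assoc kernel_at_def)
    finally show ?thesis .
  qed
  have conv: "\<exists>N0. \<forall>N\<ge>N0. \<forall>M\<ge>N0. \<bar>ip (R M) (R N) - S\<bar> < e" if "e > 0" for e
    using gram[OF that] unfolding T .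
  have LR: "(\<lambda>N. ip f (R N)) \<longlonglongrightarrow> L f" if "f \<in> H" for f
    using L[OF that] by (simp add: ipR[OF that])
  have diag: "(\<lambda>N. ip (R N) (R N)) \<longlonglongrightarrow> S"
    unfolding LIMSEQ_iff real_norm_def using conv by meson
  have S0: "S \<ge> 0"
    by (rule LIMSEQ_le_const[OF diag]) (use ip_nonneg[OF R] in blast)
  have sqrt_diag: "(\<lambda>N. sqrt (ip (R N) (R N))) \<longlonglongrightarrow> sqrt S"
    by (rule tendsto_real_sqrt[OF diag])
  have LRN: "(\<lambda>N. L (R N)) \<longlonglongrightarrow> S"
    unfolding LIMSEQ_iff real_norm_def
  proof (intro allI impI)
    fix e :: real assume "e > 0"
    then obtain N0 where N0: "\<And>N M. N \<ge> N0 \<Longrightarrow> M \<ge> N0 \<Longrightarrow> \<bar>ip (R M) (R N) - S\<bar> < e / 2"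
      using conv[of "e / 2"] by auto
    have "\<bar>L (R M) - S\<bar> \<le> e / 2" if "M \<ge> N0" for M
    proof (rule LIMSEQ_le_const2)
      show "(\<lambda>N. \<bar>ip (R M) (R N) - S\<bar>) \<longlonglongrightarrow> \<bar>L (R M) - S\<bar>"
        by (intro tendsto_intros LR R)
      show "\<exists>N1. \<forall>N\<ge>N1. \<bar>ip (R M) (R N) - S\<bar> \<le> e / 2"
        using N0 that by (meson less_imp_le)
    qed
    then have "\<forall>M\<ge>N0. \<bar>L (R M) - S\<bar> < e" using \<open>e > 0\<close> by fastforce
    then show "\<exists>N0. \<forall>M\<ge>N0. \<bar>L (R M) - S\<bar> < e" ..
  qed
  have bound: "\<bar>L f\<bar> \<le> sqrt (ip f f) * sqrt S" if f: "f \<in> H" for f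
  proof (rule LIMSEQ_le)
    show "(\<lambda>N. \<bar>ip f (R N)\<bar>) \<longlonglongrightarrow> \<bar>L f\<bar>" by (intro tendsto_intros LR f)
    show "(\<lambda>N. sqrt (ip f f) * sqrt (ip (R N) (R N))) \<longlonglongrightarrow> sqrt (ip f f) * sqrt S"
      by (intro tendsto_intros sqrt_diag)
    show "\<exists>N0. \<forall>N\<ge>N0. \<bar>ip f (R N)\<bar> \<le> sqrt (ip f f) * sqrt (ip (R N) (R N))"
      using Cauchy_Schwarz[OF f R] by blast
  qed
  let ?B = "{f \<in> H. sqrt (ip f f) \<le> 1}"
  define U where "U = (SUP f\<in>?B. \<bar>L f\<bar>)"
  have zero: "(\<lambda>x. 0) \<in> ?B"
    using ip_scale[OF zero_mem zero_mem, of 0] zero_mem by simp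
  have le: "\<bar>L f\<bar> \<le> sqrt S" if "f \<in> ?B" for f
  proof -
    have "\<bar>L f\<bar> \<le> sqrt (ip f f) * sqrt S" using bound that by blast
    also have "\<dots> \<le> 1 * sqrt S" using that S0 by (intro mult_right_mono) auto
    finally show ?thesis by simp
  qed
  have bdd: "bdd_above ((\<lambda>f. \<bar>L f\<bar>) ` ?B)"
    by (rule bdd_aboveI2[where M = "sqrt S"]) (rule le)
  have U_ge: "\<bar>L f\<bar> \<le> U" if "f \<in> ?B" for f
    unfolding U_def using that bdd by (rule cSUP_upper)
  have U0: "U \<ge> 0" using U_ge[OF zero] by simp
  have "U \<le> sqrt S"
    unfolding U_def using zero le by (intro cSUP_least) blast+
  moreover have "sqrt S \<le> U"
  proof (cases "S = 0")
    case False
    have hom: "\<bar>L f\<bar> \<le> U * sqrt (ip f f)" if f: "f \<in> H" for f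
    proof (cases "ip f f = 0")
      case True
      then show ?thesis using bound[OF f] by simp
    next
      case False
      then have p: "sqrt (ip f f) > 0" using ip_nonneg[OF f] by simp
      let ?r = "1 / sqrt (ip f f)"
      let ?g = "\<lambda>x. ?r * f x"
      have g: "?g \<in> H" by (rule scale_mem[OF f])
      have "ip ?g ?g = ?r * (?r * ip f f)"
        using ip_scale[OF f g, of ?r] ip_scale_right[OF f f, of ?r] by simp
      also have "\<dots> = 1" using p by (simp add: field_simps flip: real_sqrt_mult)
      finally have gB: "?g \<in> ?B" using g by simp
      have "(\<lambda>N. ip ?g (R N)) \<longlonglongrightarrow> ?r * L f"
        unfolding ip_scale[OF f R] by (intro tendsto_intros LR f)
      then have "L ?g = ?r * L f" using LR[OF g] LIMSEQ_unique by blast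
      then have "\<bar>?r * L f\<bar> \<le> U" using U_ge[OF gB] by simp
      then show ?thesis using p by (simp add: abs_mult pos_divide_le_eq)
    qed
    have "S \<le> U * sqrt S"
    proof (rule LIMSEQ_le)
      show "(\<lambda>N. L (R N)) \<longlonglongrightarrow> S" by (rule LRN)
      show "(\<lambda>N. U * sqrt (ip (R N) (R N))) \<longlonglongrightarrow> U * sqrt S"
        by (intro tendsto_intros sqrt_diag)
      show "\<exists>N0. \<forall>N\<ge>N0. L (R N) \<le> U * sqrt (ip (R N) (R N))"
        using hom[OF R] abs_le_D1 by blast
    qed
    then have "sqrt S * sqrt S \<le> U * sqrt S" using S0 by simp
    moreover have "sqrt S > 0" using False S0 by simp
    ultimately show ?thesis by (rule mult_right_le_imp_le)
  qed (use U0 in simp)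
  ultimately have "U = sqrt S" by simp
  then show ?thesis unfolding U_def[symmetric] using S0 by simp
qed

end

text \<open>The difference \<open>f x - f y\<close> is the inner product of \<open>f\<close> with the difference of two kernel
  sections, and the norm of that difference tends to 0 with \<open>x\<close> tending to \<open>y\<close>.\<close>

lemma rkhs_continuous_on:
  fixes D :: "'a :: t2_space set"
  assumes "rkhs D K H ip" and cont: "continuous_on (D \<times> D) (\<lambda>(x, y). K x y)" and f: "f \<in> H"
  shows "continuous_on D f"
proof -
  interpret rkhs D K H ip by fact
  show ?thesis
    unfolding continuous_on_def
  proof
    fix y assume y: "y \<in> D"
    let ?d = "\<lambda>x. sqrt (ip f f) * sqrt (K x x - K x y - K y x + K y y)"
    have bnd: "norm (f x - f y) \<le> ?d x" if x: "x \<in> D" for x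
    proof -
      note k = kernel_at_mem[OF x] kernel_at_mem[OF y]
      let ?h = "\<lambda>u. kernel_at x u - kernel_at y u"
      have h: "?h \<in> H" by (rule diff_mem[OF k])
      have ipg: "ip g ?h = g x - g y" if "g \<in> H" for g
        using ip_commute[OF that h] ip_diff[OF k that] ip_commute[OF k(1) that] ip_commute[OF k(2) that]
          ip_kernel_at[OF that x] ip_kernel_at[OF that y] by simp
      have "ip ?h ?h = K x x - K x y - K y x + K y y"
        unfolding ipg[OF h] using x y by (simp add: kernel_at_def)
      then show ?thesis using Cauchy_Schwarz[OF f h] ipg[OF f] by simp
    qed
    have c: "continuous_on D (\<lambda>x. K (g x) (h x))"
      if "continuous_on D g" "continuous_on D h" "g ` D \<subseteq> D" "h ` D \<subseteq> D" for g h
      using continuous_on_compose2[OF cont, of D "\<lambda>x. (g x, h x)"] that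
      by (auto intro!: continuous_intros)
    have "continuous_on D ?d"
      using y by (intro continuous_intros c) auto
    then have "(?d \<longlongrightarrow> ?d y) (at y within D)" unfolding continuous_on_def using y by (rule bspec)
    then have d: "(?d \<longlongrightarrow> 0) (at y within D)" by simp
    have "((\<lambda>x. f x - f y) \<longlongrightarrow> 0) (at y within D)"
      using bnd by (intro Lim_null_comparison[OF _ d]) (auto simp: eventually_at_filter)
    then show "(f \<longlongrightarrow> f y) (at y within D)" by (rule LIM_zero_cancel)
  qed
qed

section \<open>The error formula\<close>

text \<open>Dominated convergence for absolutely convergent sums. The factors are assumed to be
  eventually equal to their limits, index by index, so that only a tail of the sum changes.\<close>

lemma tendsto_infsum_eventually_eq:
  fixes g :: "'p \<Rightarrow> complex" and u :: "'n \<Rightarrow> 'p \<Rightarrow> complex"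
  assumes g: "(\<lambda>p. norm (g p)) summable_on UNIV"
    and u: "\<And>n p. norm (u n p) \<le> B" and v: "\<And>p. norm (v p) \<le> B"
    and ev: "\<And>p. \<forall>\<^sub>F n in F. u n p = v p"
  shows "((\<lambda>n. \<Sum>\<^sub>\<infinity>p. g p * u n p) \<longlongrightarrow> (\<Sum>\<^sub>\<infinity>p. g p * v p)) F"
proof (rule tendstoI)
  fix e :: real assume "e > 0"
  have B0: "B \<ge> 0" using norm_ge_zero v by (rule order_trans)
  have dom: "(\<lambda>p. norm (g p * w p)) summable_on A" if "\<And>p. norm (w p) \<le> C" for w C A
  proof (rule summable_on_comparison_test)
    show "(\<lambda>p. norm (g p) * C) summable_on A"
      by (intro summable_on_cmult_left summable_on_subset_banach[OF g]) simp
    show "norm (g p * w p) \<le> norm (g p) * C" for p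
      unfolding norm_mult using that by (intro mult_left_mono) auto
  qed simp
  \<comment> \<open>The added 1 keeps the quotient meaningful for B = 0.\<close>
  define d where "d = e / (2 * B + 1) / 2"
  have "d > 0" using \<open>e > 0\<close> B0 by (simp add: d_def)
  then obtain X where X: "finite X" "dist (\<Sum>p\<in>X. norm (g p)) (\<Sum>\<^sub>\<infinity>p. norm (g p)) \<le> d"
    using infsum_finite_approximation[OF g] by blast
  have gX: "(\<lambda>p. norm (g p)) summable_on - X"
    by (rule summable_on_subset_banach[OF g]) simp
  have "(\<Sum>\<^sub>\<infinity>p. norm (g p)) = (\<Sum>p\<in>X. norm (g p)) + (\<Sum>\<^sub>\<infinity>p\<in>-X. norm (g p))"
    using infsum_Un_disjoint[of "\<lambda>p. norm (g p)" X "- X"] gX X(1) by (simp add: Un_commute Compl_partition)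
  then have tail: "(\<Sum>\<^sub>\<infinity>p\<in>-X. norm (g p)) \<le> d"
    using X(2) by (simp add: dist_real_def)
  have "\<forall>\<^sub>F n in F. \<forall>p\<in>X. u n p = v p"
    using X(1) ev by (intro eventually_ball_finite) auto
  then show "\<forall>\<^sub>F n in F. dist (\<Sum>\<^sub>\<infinity>p. g p * u n p) (\<Sum>\<^sub>\<infinity>p. g p * v p) < e"
  proof eventually_elim
    case (elim n)
    have uv: "norm (u n p - v p) \<le> 2 * B" for p
      using norm_triangle_ineq4[of "u n p" "v p"] u[of n p] v[of p] by linarith
    have "(\<lambda>p. g p * u n p) summable_on UNIV" "(\<lambda>p. g p * v p) summable_on UNIV"
      using dom[of "u n" B UNIV] dom[of v B UNIV] u v by (auto intro: abs_summable_summable)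
    then have "(\<Sum>\<^sub>\<infinity>p. g p * u n p) - (\<Sum>\<^sub>\<infinity>p. g p * v p) = (\<Sum>\<^sub>\<infinity>p. g p * u n p - g p * v p)"
      using infsum_add[of "\<lambda>p. g p * u n p" UNIV "\<lambda>p. - (g p * v p)"]
      by (simp add: infsum_uminus summable_on_uminus)
    also have "\<dots> = (\<Sum>\<^sub>\<infinity>p\<in>-X. g p * (u n p - v p))"
      using elim by (intro infsum_cong_neutral) (auto simp: right_diff_distrib)
    also have "norm \<dots> \<le> (\<Sum>\<^sub>\<infinity>p\<in>-X. norm (g p * (u n p - v p)))"
      by (intro norm_infsum_bound dom[OF uv])
    also have "\<dots> \<le> (\<Sum>\<^sub>\<infinity>p\<in>-X. norm (g p) * (2 * B))"
      using uv by (intro infsum_mono dom[OF uv] summable_on_cmult_left gX) (auto simp: norm_mult intro!: mult_left_mono)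
    also have "\<dots> = (\<Sum>\<^sub>\<infinity>p\<in>-X. norm (g p)) * (2 * B)"
      by (rule infsum_cmult_left) (use gX in simp)
    also have "\<dots> \<le> d * (2 * B)" using tail B0 by (intro mult_right_mono) auto
    also have "\<dots> < e"
    proof -
      have "0 < e * 2 + B * (e * 2)" using \<open>e > 0\<close> B0 by (intro add_pos_nonneg) auto
      then show ?thesis using B0 by (simp add: d_def field_simps)
    qed
    finally show ?case by (simp add: dist_norm)
  qed
qed

lemma sum_mset_symmetrized_net:
  fixes C :: "'s::finite \<Rightarrow> nat \<Rightarrow> nat \<Rightarrow> nat" and \<phi> :: "(nat \<Rightarrow> nat) ^ 's \<Rightarrow> 'a :: comm_monoid_add"
  shows "(\<Sum>z\<in>#symmetrization b (digital_net b m C). \<phi> z)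
    = (\<Sum>(n, l)\<in>{..<b ^ m} \<times> {l. \<forall>j. l $ j < b}. \<phi> (add_G b (net_point b m C n) (const_G l)))"
proof -
  have "(\<Sum>z\<in>#(\<Sum>n\<in>#P. image_mset (h n) Q). \<phi> z) = (\<Sum>n\<in>#P. \<Sum>l\<in>#Q. \<phi> (h n l))"
    for P :: "'x multiset" and Q :: "'y multiset" and h
    by (induction P) (auto simp: image_mset.compositionality comp_def)
  from this[of "\<lambda>z l. add_G b z (const_G l)" "mset_set {l. \<forall>j. l $ j < b}" "digital_net b m C"]
  show ?thesis
    by (simp add: symmetrization_def digital_net_def image_mset.compositionality comp_def
        sum_unfold_sum_mset[symmetric] sum.cartesian_product)
qed

lemma size_symmetrized_net:
  fixes C :: "'s::finite \<Rightarrow> nat \<Rightarrow> nat \<Rightarrow> nat"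
  shows "size (symmetrization b (digital_net b m C)) = b ^ m * b ^ CARD('s)"
proof -
  have "size (symmetrization b (digital_net b m C))
      = (\<Sum>(n, l)\<in>{..<b ^ m} \<times> {l :: nat ^ 's. \<forall>j. l $ j < b}. 1)"
    unfolding size_eq_sum_mset by (rule sum_mset_symmetrized_net)
  also have "\<dots> = card ({..<b ^ m} \<times> {l :: nat ^ 's. \<forall>j. l $ j < b})"
    by (simp only: split_def card_eq_sum)
  also have "\<dots> = b ^ m * b ^ CARD('s)"
    using card_vec_less[where n = b and 's = 's] by (simp add: card_cartesian_product)
  finally show ?thesis .
qed

lemma eq_0_if_digits_0:
  assumes "b \<ge> 2" and "k < b ^ N" and "\<And>i. i < N \<Longrightarrow> nat_digit b k i = 0"
  shows "k = 0"
proof -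
  have "n \<le> N \<Longrightarrow> k mod b ^ n = 0" for n
  proof (induction n)
    case (Suc n)
    then have "k mod (b ^ n * b) = 0"
      using assms(3)[of n] by (simp add: mod_mult2_eq nat_digit_def)
    then show ?case by (simp add: mult.commute)
  qed simp
  then show ?thesis using assms(2) by force
qed

text \<open>The grid average minus the average over the symmetrized net is a finite combination of
  point evaluations that approximates the integration error. The type of its indices keeps the two
  point sets apart, since points count with multiplicity.\<close>

type_synonym 's error_index = "(nat ^ 's) + (nat \<times> (nat ^ 's))"

definition error_index_set :: "nat \<Rightarrow> nat \<Rightarrow> nat \<Rightarrow> ('s::finite) error_index set" where
  "error_index_set b m N = index_box b N <+> ({..<b ^ m} \<times> {l. \<forall>j. l $ j < b})"

definition error_point ::
  "nat \<Rightarrow> nat \<Rightarrow> ('s \<Rightarrow> nat \<Rightarrow> nat \<Rightarrow> nat) \<Rightarrow> nat \<Rightarrow> 's error_index \<Rightarrow> (nat \<Rightarrow> nat) ^ 's" where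
  "error_point b m C N =
    case_sum (grid_point b N) (\<lambda>(n, l). add_G b (net_point b m C n) (const_G l))"

definition error_weight :: "nat \<Rightarrow> nat \<Rightarrow> nat \<Rightarrow> ('s::finite) error_index \<Rightarrow> real" where
  "error_weight b m N =
    case_sum (\<lambda>_. 1 / real b ^ (N * CARD('s))) (\<lambda>_. - 1 / (real b ^ m * real b ^ CARD('s)))"

lemma finite_error_index_set [simp]: "finite (error_index_set b m N :: ('s::finite) error_index set)"
  using card_vec_less[where n = b and 's = 's] by (simp add: error_index_set_def)

lemma error_point_less: "b \<ge> 2 \<Longrightarrow> (error_point b m C N i $ j) r < b"
  by (cases i) (auto simp: error_point_def grid_point_less add_G_def)

lemma sum_error_index_set:
  fixes h :: "('s::finite) error_index \<Rightarrow> 'a :: comm_monoid_add"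
  shows "sum h (error_index_set b m N)
    = (\<Sum>a\<in>index_box b N. h (Inl a)) + (\<Sum>p\<in>{..<b ^ m} \<times> {l. \<forall>j. l $ j < b}. h (Inr p))"
  unfolding error_index_set_def using card_vec_less[where n = b and 's = 's]
  by (subst sum.Plus) auto

abbreviation dual_E :: "nat \<Rightarrow> nat \<Rightarrow> ('s::finite \<Rightarrow> nat \<Rightarrow> nat \<Rightarrow> nat) \<Rightarrow> (nat ^ 's) set" where
  "dual_E b m C \<equiv> dual_net b m C \<inter> {k. \<forall>j. k $ j \<in> E_set b}"

text \<open>The finite functionals act on characters by a difference of two indicator functions, one for
  the dual of the grid and one for the dual of the symmetrized net. As \<open>N\<close> grows, the former
  shrinks to the index 0.\<close>

lemma error_functional_char:
  fixes C :: "'s::finite \<Rightarrow> nat \<Rightarrow> nat \<Rightarrow> nat"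
  assumes b: "b \<ge> 2"
  shows "(\<Sum>i\<in>error_index_set b m N. of_real (error_weight b m N i) * char_G b k (error_point b m C N i))
    = of_bool (\<forall>j. \<forall>i<N. nat_digit b (k $ j) i = 0) - of_bool (k \<in> dual_E b m C)"
proof -
  have "(\<Sum>i\<in>error_index_set b m N. of_real (error_weight b m N i) * char_G b k (error_point b m C N i))
    = of_real (1 / real b ^ (N * CARD('s))) * (\<Sum>a\<in>index_box b N. char_G b k (grid_point b N a))
      + of_real (- 1 / (real b ^ m * real b ^ CARD('s))) *
        (\<Sum>(n, l)\<in>{..<b ^ m} \<times> {l. \<forall>j. l $ j < b}. char_G b k (add_G b (net_point b m C n) (const_G l)))"
    by (simp only: sum_error_index_set error_weight_def error_point_def sum.case sum_distrib_left split_def)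
  then show ?thesis
    using b by (simp add: sum_char_grid[OF b] sum_char_symmetrized_net[OF b] del: Int_iff)
qed

lemma error_functional_tendsto:
  fixes m :: nat and C :: "'s::finite \<Rightarrow> nat \<Rightarrow> nat \<Rightarrow> nat" and f :: "real ^ 's \<Rightarrow> real"
  assumes b: "b \<ge> 2" and f: "continuous_on unit_cube f"
  defines "P \<equiv> image_mset (proj_G b) (symmetrization b (digital_net b m C))"
  shows "(\<lambda>N. \<Sum>i\<in>error_index_set b m N. error_weight b m N i * f (proj_G b (error_point b m C N i)))
    \<longlonglongrightarrow> set_lebesgue_integral lborel unit_cube f - (\<Sum>x\<in>#P. f x) / real (size P)"
proof -
  let ?Z = "{..<b ^ m} \<times> {l :: nat ^ 's. \<forall>j. l $ j < b}"
  have P: "(\<Sum>x\<in>#P. f x) = (\<Sum>(n, l)\<in>?Z. f (proj_G b (add_G b (net_point b m C n) (const_G l))))"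
    using sum_mset_symmetrized_net[of "\<lambda>z. f (proj_G b z)" b m C]
    by (simp add: P_def image_mset.compositionality comp_def)
  have size: "real (size P) = real b ^ m * real b ^ CARD('s)"
    by (simp add: P_def size_symmetrized_net)
  have eq: "(\<Sum>i\<in>error_index_set b m N. error_weight b m N i * f (proj_G b (error_point b m C N i)))
    = (\<Sum>a\<in>index_box b N. 1 / real b ^ (N * CARD('s)) * f (proj_G b (grid_point b N a)))
      - (\<Sum>x\<in>#P. f x) / real (size P)" for N
  proof -
    have "(\<Sum>i\<in>error_index_set b m N. error_weight b m N i * f (proj_G b (error_point b m C N i)))
      = (\<Sum>a\<in>index_box b N. 1 / real b ^ (N * CARD('s)) * f (proj_G b (grid_point b N a)))
        + (\<Sum>(n, l)\<in>?Z. - 1 / (real b ^ m * real b ^ CARD('s)) *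
            f (proj_G b (add_G b (net_point b m C n) (const_G l))))"
      by (simp only: sum_error_index_set error_weight_def error_point_def sum.case split_def)
    also have "(\<Sum>(n, l)\<in>?Z. - 1 / (real b ^ m * real b ^ CARD('s)) *
            f (proj_G b (add_G b (net_point b m C n) (const_G l))))
        = - 1 / (real b ^ m * real b ^ CARD('s)) * (\<Sum>x\<in>#P. f x)"
      unfolding P split_def by (rule sum_distrib_left[symmetric])
    finally show ?thesis by (simp add: size)
  qed
  show ?thesis
    unfolding eq by (rule tendsto_diff[OF grid_average_tendsto_integral[OF b f] tendsto_const])
qed

lemma has_sum_finite_sum:
  fixes f :: "'i \<Rightarrow> 'p \<Rightarrow> 'b :: {topological_comm_monoid_add, t2_space}"
  assumes "finite I" and "\<And>i. i \<in> I \<Longrightarrow> (f i has_sum s i) A"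
  shows "((\<lambda>p. \<Sum>i\<in>I. f i p) has_sum (\<Sum>i\<in>I. s i)) A"
  using assms by (induction I rule: finite_induct) (auto intro: has_sum_add)

lemma error_gram_has_sum:
  fixes K :: "real ^ 's::finite \<Rightarrow> real ^ 's \<Rightarrow> real" and C :: "'s \<Rightarrow> nat \<Rightarrow> nat \<Rightarrow> nat" and m :: nat
  assumes b: "b \<ge> 2" and cont: "continuous_on (unit_cube \<times> unit_cube) (\<lambda>(x, y). K x y)"
    and summ: "(\<lambda>(k, l). norm (walsh_coeff b K k l)) summable_on UNIV"
  defines "a \<equiv> \<lambda>N k. of_bool (\<forall>j. \<forall>i<N. nat_digit b (k $ j) i = 0) - of_bool (k \<in> dual_E b m C)"
  shows "((\<lambda>(k, l). walsh_coeff b K k l * (a N k * a M l)) has_sum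
    of_real (\<Sum>i\<in>error_index_set b m N. \<Sum>j\<in>error_index_set b m M.
      error_weight b m N i * error_weight b m M j *
      K (proj_G b (error_point b m C N i)) (proj_G b (error_point b m C M j)))) UNIV"
proof -
  let ?I = "error_index_set b m" and ?w = "\<lambda>N i. complex_of_real (error_weight b m N i)"
    and ?z = "error_point b m C"
  let ?f = "\<lambda>i j p. ?w N i * ?w M j *
    (\<lambda>(k, l). walsh_coeff b K k l * (char_G b k (?z N i) * cnj (char_G b l (?z M j)))) p"
  have "((\<lambda>p. \<Sum>i\<in>?I N. \<Sum>j\<in>?I M. ?f i j p) has_sum
    (\<Sum>i\<in>?I N. \<Sum>j\<in>?I M. ?w N i * ?w M j * of_real (K (proj_G b (?z N i)) (proj_G b (?z M j))))) UNIV"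
    by (intro has_sum_finite_sum finite_error_index_set has_sum_cmult_right
        walsh_expansion[OF b cont summ] error_point_less[OF b])
  moreover have "(\<Sum>i\<in>?I N. \<Sum>j\<in>?I M. ?f i j (k, l)) = walsh_coeff b K k l * (a N k * a M l)" for k l
  proof -
    have "(\<Sum>i\<in>?I N. \<Sum>j\<in>?I M. ?f i j (k, l))
      = (\<Sum>i\<in>?I N. \<Sum>j\<in>?I M. walsh_coeff b K k l *
          ((?w N i * char_G b k (?z N i)) * cnj (?w M j * char_G b l (?z M j))))"
      by (simp add: mult_ac)
    also have "\<dots> = walsh_coeff b K k l * ((\<Sum>i\<in>?I N. ?w N i * char_G b k (?z N i)) *
        cnj (\<Sum>j\<in>?I M. ?w M j * char_G b l (?z M j)))"
      unfolding cnj_sum by (subst sum_product) (simp only: sum_distrib_left)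
    also have "\<dots> = walsh_coeff b K k l * (a N k * a M l)"
      unfolding error_functional_char[OF b] a_def by simp
    finally show ?thesis .
  qed
  ultimately show ?thesis by (simp add: split_def)
qed

lemma zero_mem_dual_E: "0 \<in> dual_E b m C"
  by (simp add: dual_net_def E_set_def digit_sum_def digit_supp_def nat_digit_def)

text \<open>The Walsh coefficients are multiplied by products of differences of indicators, which are
  eventually constant in \<open>N\<close> and \<open>M\<close>. Since 0 lies in the dual of the symmetrized net, the
  limiting differences are \<open>- 1\<close> on its nonzero elements and 0 elsewhere; the signs cancel in
  the product.\<close>

lemma error_gram_tendsto:
  fixes K :: "real ^ 's::finite \<Rightarrow> real ^ 's \<Rightarrow> real" and C :: "'s \<Rightarrow> nat \<Rightarrow> nat \<Rightarrow> nat" and m :: nat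
  assumes b: "b \<ge> 2" and cont: "continuous_on (unit_cube \<times> unit_cube) (\<lambda>(x, y). K x y)"
    and summ: "(\<lambda>(k, l). norm (walsh_coeff b K k l)) summable_on UNIV"
  shows "((\<lambda>(N, M). complex_of_real (\<Sum>i\<in>error_index_set b m N. \<Sum>j\<in>error_index_set b m M.
      error_weight b m N i * error_weight b m M j *
      K (proj_G b (error_point b m C N i)) (proj_G b (error_point b m C M j))))
    \<longlongrightarrow> (\<Sum>\<^sub>\<infinity>(k, l)\<in>(dual_E b m C - {0}) \<times> (dual_E b m C - {0}). walsh_coeff b K k l))
    (sequentially \<times>\<^sub>F sequentially)"
proof -
  let ?g = "\<lambda>p :: (nat ^ 's) \<times> (nat ^ 's). walsh_coeff b K (fst p) (snd p)"
  define a :: "nat \<Rightarrow> nat ^ 's \<Rightarrow> complex"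
    where "a N k = of_bool (\<forall>j. \<forall>i<N. nat_digit b (k $ j) i = 0) - of_bool (k \<in> dual_E b m C)" for N k
  define v :: "nat ^ 's \<Rightarrow> complex" where "v k = of_bool (k = 0) - of_bool (k \<in> dual_E b m C)" for k
  have a1: "norm (a N k) \<le> 1" for N k by (simp add: a_def)
  have v1: "norm (v k) \<le> 1" for k by (simp add: v_def)
  have v_eq: "v k = - of_bool (k \<in> dual_E b m C - {0})" for k
    using zero_mem_dual_E[of b m C] by (auto simp: v_def)
  have ev: "\<forall>\<^sub>F N in sequentially. a N k = v k" for k
    using index_box_exhausts[OF b, of k]
  proof eventually_elim
    case (elim N)
    have "(\<forall>j. \<forall>i<N. nat_digit b (k $ j) i = 0) \<longleftrightarrow> k = 0"
    proof
      assume *: "\<forall>j. \<forall>i<N. nat_digit b (k $ j) i = 0"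
      have "k $ j = 0" for j
        by (rule eq_0_if_digits_0[OF b, where N = N]) (use elim * in \<open>auto simp: index_box_def\<close>)
      then show "k = 0" by (simp add: vec_eq_iff)
    qed (simp add: nat_digit_def)
    then show ?case by (simp add: a_def v_def)
  qed
  have "((\<lambda>n. \<Sum>\<^sub>\<infinity>p. ?g p * (a (fst n) (fst p) * a (snd n) (snd p)))
    \<longlongrightarrow> (\<Sum>\<^sub>\<infinity>p. ?g p * (v (fst p) * v (snd p)))) (sequentially \<times>\<^sub>F sequentially)"
  proof (rule tendsto_infsum_eventually_eq[where B = 1])
    show "(\<lambda>p. norm (?g p)) summable_on UNIV" using summ by (simp add: split_def)
    show "norm (a (fst n) (fst p) * a (snd n) (snd p)) \<le> 1" for n p
      unfolding norm_mult by (intro mult_le_one a1 norm_ge_zero)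
    show "norm (v (fst p) * v (snd p)) \<le> 1" for p
      unfolding norm_mult by (intro mult_le_one v1 norm_ge_zero)
    show "\<forall>\<^sub>F n in sequentially \<times>\<^sub>F sequentially.
      a (fst n) (fst p) * a (snd n) (snd p) = v (fst p) * v (snd p)" for p
      using eventually_prodI[OF ev[of "fst p"] ev[of "snd p"]] by eventually_elim auto
  qed
  moreover have "(\<Sum>\<^sub>\<infinity>p. ?g p * (v (fst p) * v (snd p)))
      = (\<Sum>\<^sub>\<infinity>(k, l)\<in>(dual_E b m C - {0}) \<times> (dual_E b m C - {0}). walsh_coeff b K k l)"
    by (rule infsum_cong_neutral) (auto simp: v_eq)
  moreover have "(\<lambda>n. \<Sum>\<^sub>\<infinity>p. ?g p * (a (fst n) (fst p) * a (snd n) (snd p)))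
      = (\<lambda>(N, M). complex_of_real (\<Sum>i\<in>error_index_set b m N. \<Sum>j\<in>error_index_set b m M.
      error_weight b m N i * error_weight b m M j *
      K (proj_G b (error_point b m C N i)) (proj_G b (error_point b m C M j))))"
    using infsumI[OF error_gram_has_sum[OF b cont summ, where m = m and C = C, folded a_def]]
    by (simp add: fun_eq_iff split_def)
  ultimately show ?thesis by simp
qed

theorem theorem16:
  fixes b m :: nat
    and C :: "'s::finite \<Rightarrow> nat \<Rightarrow> nat \<Rightarrow> nat"
    and K :: "real ^ 's \<Rightarrow> real ^ 's \<Rightarrow> real"
    and H :: "(real ^ 's \<Rightarrow> real) set"
    and ip :: "(real ^ 's \<Rightarrow> real) \<Rightarrow> (real ^ 's \<Rightarrow> real) \<Rightarrow> real"
  assumes "b \<ge> 2"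
    and "m \<ge> 1"
    and "generating_matrices b m C"
    and "rkhs unit_cube K H ip"
    and "continuous_on (unit_cube \<times> unit_cube) (\<lambda>(x, y). K x y)"
    and "set_integrable lborel unit_cube (\<lambda>x. sqrt (K x x))"
    and "(\<lambda>(k, l). norm (walsh_coeff b K k l)) summable_on UNIV"
  shows "complex_of_real
           ((worst_case_error H ip
               (image_mset (proj_G b) (symmetrization b (digital_net b m C))))\<^sup>2) =
         (\<Sum>\<^sub>\<infinity>(k, l) \<in>
            ((dual_net b m C \<inter> {k. \<forall>j. k $ j \<in> E_set b}) - {0}) \<times>
            ((dual_net b m C \<inter> {k. \<forall>j. k $ j \<in> E_set b}) - {0}).
            walsh_coeff b K k l)" (is "_ = ?S")
proof -
  interpret rkhs unit_cube K H ip by fact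
  let ?F = "sequentially \<times>\<^sub>F sequentially"
  define T where "T N M = (\<Sum>i\<in>error_index_set b m N. \<Sum>j\<in>error_index_set b m M.
      error_weight b m N i * error_weight b m M j *
      K (proj_G b (error_point b m C N i)) (proj_G b (error_point b m C M j)))" for N M
  \<comment> \<open>The coefficients are complex, but their sum is a limit of real numbers.\<close>
  have lim: "((\<lambda>(N, M). complex_of_real (T N M)) \<longlongrightarrow> ?S) ?F"
    unfolding T_def by (rule error_gram_tendsto) fact+
  have nb: "?F \<noteq> bot" by (simp add: prod_filter_eq_bot)
  have limRe: "((\<lambda>(N, M). T N M) \<longlongrightarrow> Re ?S) ?F"
    using tendsto_Re[OF lim] by (simp add: split_def)
  have "((\<lambda>_. 0) \<longlongrightarrow> Im ?S) ?F"
    using tendsto_Im[OF lim] by (simp add: split_def)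
  then have "Im ?S = 0" using tendsto_unique[OF nb] tendsto_const by blast
  then have S_real: "?S = complex_of_real (Re ?S)" by (simp add: complex_eq_iff)
  have "(worst_case_error H ip (image_mset (proj_G b) (symmetrization b (digital_net b m C))))\<^sup>2 = Re ?S"
    unfolding worst_case_error_def
  proof (rule SUP_functional_power2[where I = "error_index_set b m" and c = "error_weight b m"
        and x = "\<lambda>N i. proj_G b (error_point b m C N i)"])
    show "proj_G b (error_point b m C N i) \<in> unit_cube" for N i
      by (intro proj_G_in_cube error_point_less assms)
    show "(\<lambda>N. \<Sum>i\<in>error_index_set b m N. error_weight b m N i * f (proj_G b (error_point b m C N i)))
      \<longlonglongrightarrow> set_lebesgue_integral lborel unit_cube f -
        (\<Sum>x\<in>#image_mset (proj_G b) (symmetrization b (digital_net b m C)). f x) /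
        real (size (image_mset (proj_G b) (symmetrization b (digital_net b m C))))" if "f \<in> H" for f
      by (intro error_functional_tendsto rkhs_continuous_on[OF assms(4,5) that] assms)
    fix e :: real assume "e > 0"
    from tendstoD[OF limRe this]
    show "\<exists>N0. \<forall>N\<ge>N0. \<forall>M\<ge>N0. \<bar>(\<Sum>i\<in>error_index_set b m N. \<Sum>j\<in>error_index_set b m M.
        error_weight b m N i * error_weight b m M j *
        K (proj_G b (error_point b m C N i)) (proj_G b (error_point b m C M j))) - Re ?S\<bar> < e"
      unfolding eventually_prod_sequentially T_def[symmetric] by (auto simp: dist_real_def)
  qed simp
  then show ?thesis using S_real by simp
qed

end
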